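(* Let $n\ge1$. The module $U_{2n,2}$ is a free $R_{2n}$-module of rank $\binom{2n}{2}$ with the following elements as a basis: $$v_{i_1}^{(2n)}\wedge v_{i_2}^{(2n)}\ (1\le i_1<i_2\le n),\qquad w_{j_1}^{(2n)}\wedge w_{j_2}^{(2n)}\ (1\le j_1<j_2\le n),$$ $$v_i^{(2n)}\wedge w_j^{(2n)}\ (1\le i\le n,\ 1\le j\le n-1),\qquad \xi_k^{(2n)}\ (1\le k\le n).$$
   Context: $R_{2n}$ is the ring of symmetric polynomials in $x_1,\dots,x_{2n}$ over $\mathbb C$; $H^{(2n)}=\bigoplus_{k=0}^{2n-1}R_{2n}X^k$. $\wedge^2H^{(2n)}$ is identified with the space of anti-symmetric polynomials $P(X_1,X_2|x_1,\dots,x_{2n})$ in $X_1,X_2$ of degree less than $2n$ in each variable with coefficients in $R_{2n}$, via $X^i\wedge X^j\mapsto X_1^iX_2^j-X_2^iX_1^j$. $U_{2n,2}$ is the $R_{2n}$-submodule of all $P\in\wedge^2H^{(2n)}$ with $P(X_1,x^{-1}|x_1,\dots,x_{2n-2},x,-x)=0$ and $P(X_1,-x^{-1}|x_1,\dots,x_{2n-2},x,-x)=0$ identically. $e_k^{(2n)}$ is the $k$-th elementary symmetric polynomial in $x_1,\dots,x_{2n}$, with $e^{(2n)}_k=0$ for $k<0$ or $k>2n$. For $1\le r\le n$, $s\in\mathbb Z$: $P^{(2n)}_{1,s}=e^{(2n)}_{2s-1}$ and $P^{(2n)}_{r,s}=P^{(2n)}_{r-1,s+1}-e^{(2n)}_{2s}P^{(2n)}_{r-1,1}$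 for $r\ge2$. Put $v^{(2n)}_r=\sum_{s=1}^nP^{(2n)}_{r,s}X^{2(s-1)}$, $w^{(2n)}_r=Xv^{(2n)}_r$ for $1\le r\le n$, $v_0^{(2n)}=\sum_{j=0}^ne^{(2n)}_{2j}X^{2j}$, and for $1\le k\le n$ $$2\xi_k^{(2n)}(X_1,X_2)=\frac{X_1-X_2}{X_1+X_2}\Big(v_0^{(2n)}(X_1)w_k^{(2n)}(X_2)+v_0^{(2n)}(X_2)w_k^{(2n)}(X_1)\Big)-v_0^{(2n)}(X_1)w_k^{(2n)}(X_2)+v_0^{(2n)}(X_2)w_k^{(2n)}(X_1),$$ which is an anti-symmetric polynomial in $X_1,X_2$ belonging to $\wedge^2H^{(2n)}$. *)

theory Defs
  imports
    "HOL-Library.Poly_Mapping"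
    "HOL-Computational_Algebra.Polynomial"
    "HOL-Combinatorics.Permutations"
    Complex_Main
begin

text \<open>
  Polynomials over \<open>\<complex>\<close> in \<open>x\<^sub>1, x\<^sub>2, \<dots>\<close> are finitely supported functions from monomials
  (finitely supported exponent functions) to coefficients.  A polynomial
  \<open>P(X\<^sub>1, X\<^sub>2 | x)\<close> is a polynomial in the outer variable \<open>X\<^sub>1\<close> whose coefficients are
  polynomials in the inner variable \<open>X\<^sub>2\<close>; the coefficient of \<open>X\<^sub>1\<^sup>i X\<^sub>2\<^sup>j\<close> is
  \<open>coeff (coeff P i) j\<close>.
\<close>

type_synonym mpol = "(nat \<Rightarrow>\<^sub>0 nat) \<Rightarrow>\<^sub>0 complex"

definition xvar :: "nat \<Rightarrow> mpol" where
  "xvar i = Poly_Mapping.single (Poly_Mapping.single i 1) 1"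

definition eval_mpol :: "(nat \<Rightarrow> complex) \<Rightarrow> mpol \<Rightarrow> complex" where
  "eval_mpol a p =
     (\<Sum>m\<in>Poly_Mapping.keys p. Poly_Mapping.lookup p m *
        (\<Prod>i\<in>Poly_Mapping.keys m. a i ^ Poly_Mapping.lookup m i))"

definition eval_P :: "mpol poly poly \<Rightarrow> complex \<Rightarrow> complex \<Rightarrow> (nat \<Rightarrow> complex) \<Rightarrow> complex" where
  "eval_P P z1 z2 a = poly (map_poly (\<lambda>q. poly (map_poly (eval_mpol a) q) z2) P) z1"

definition sym_ring :: "nat \<Rightarrow> mpol set" where
  "sym_ring N = {p.
     (\<forall>m\<in>Poly_Mapping.keys p. Poly_Mapping.keys m \<subseteq> {1..N}) \<and>
     (\<forall>\<pi>. \<pi> permutes {1..N} \<longrightarrow>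
        (\<forall>m. Poly_Mapping.lookup p (Poly_Mapping.map_key \<pi> m) = Poly_Mapping.lookup p m))}"


subsection \<open>Submodules and bases over a subring of the coefficients\<close>

definition scale :: "'a::comm_ring_1 \<Rightarrow> 'a poly poly \<Rightarrow> 'a poly poly" where
  "scale c P = smult [:c:] P"

definition is_submodule :: "'a::comm_ring_1 set \<Rightarrow> 'a poly poly set \<Rightarrow> bool" where
  "is_submodule R M \<longleftrightarrow>
     0 \<in> M \<and> (\<forall>P\<in>M. \<forall>Q\<in>M. P + Q \<in> M) \<and> (\<forall>c\<in>R. \<forall>P\<in>M. scale c P \<in> M)"

definition is_finite_basis :: "'a::comm_ring_1 set \<Rightarrow> 'a poly poly set \<Rightarrow> 'a poly poly set \<Rightarrow> bool" where
  "is_finite_basis R M B \<longleftrightarrow>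
     finite B \<and> B \<subseteq> M \<and>
     (\<forall>P\<in>M. \<exists>c. (\<forall>b\<in>B. c b \<in> R) \<and> P = (\<Sum>b\<in>B. scale (c b) b)) \<and>
     (\<forall>c. (\<forall>b\<in>B. c b \<in> R) \<longrightarrow> (\<Sum>b\<in>B. scale (c b) b) = 0 \<longrightarrow> (\<forall>b\<in>B. c b = 0))"


subsection \<open>The module of anti-symmetric polynomials and its submodule\<close>

text \<open>
  The exterior square of \<open>H\<close>, in its identification with anti-symmetric polynomials in
  \<open>X\<^sub>1, X\<^sub>2\<close> of degree less than \<open>N\<close> in each of them.
\<close>

definition wedge2_H :: "nat \<Rightarrow> mpol poly poly set" where
  "wedge2_H N = {P.
     (\<forall>i j. coeff (coeff P i) j \<in> sym_ring N) \<and>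
     (\<forall>i j. coeff (coeff P i) j \<noteq> 0 \<longrightarrow> i < N \<and> j < N) \<and>
     (\<forall>i j. coeff (coeff P i) j = - coeff (coeff P j) i)}"

text \<open>
  The vanishing conditions are identities of rational functions over \<open>\<complex>\<close>, i.e. they hold
  for all complex values of the variables with \<open>x \<noteq> 0\<close>.
\<close>

definition U2 :: "nat \<Rightarrow> mpol poly poly set" where
  "U2 n = {P \<in> wedge2_H (2 * n).
     \<forall>z a x. x \<noteq> 0 \<longrightarrow>
       eval_P P z (inverse x) (a(2 * n - 1 := x, 2 * n := - x)) = 0 \<and>
       eval_P P z (- inverse x) (a(2 * n - 1 := x, 2 * n := - x)) = 0}"

definition X1 :: "mpol poly poly" where "X1 = [:0, 1:]"
definition X2 :: "mpol poly poly" where "X2 = [:[:0, 1:]:]"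

definition in_X1 :: "mpol poly \<Rightarrow> mpol poly poly" where
  "in_X1 f = map_poly (\<lambda>c. [:c:]) f"

definition in_X2 :: "mpol poly \<Rightarrow> mpol poly poly" where
  "in_X2 f = [:f:]"

text \<open>The bilinear extension of \<open>X\<^sup>i \<and> X\<^sup>j \<mapsto> X\<^sub>1\<^sup>i X\<^sub>2\<^sup>j - X\<^sub>2\<^sup>i X\<^sub>1\<^sup>j\<close>.\<close>

definition wedge :: "mpol poly \<Rightarrow> mpol poly \<Rightarrow> mpol poly poly" where
  "wedge f g = in_X1 f * in_X2 g - in_X2 f * in_X1 g"


subsection \<open>The basis elements\<close>

definition esym :: "nat \<Rightarrow> int \<Rightarrow> mpol" where
  "esym N k = (if k < 0 then 0
     else \<Sum>A | A \<subseteq> {1..N} \<and> card A = nat k. \<Prod>i\<in>A. xvar i)"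

text \<open>The index \<open>r\<close> starts at 1; the value at \<open>r = 0\<close> is a dummy.\<close>

fun Pcoef :: "nat \<Rightarrow> nat \<Rightarrow> int \<Rightarrow> mpol" where
  "Pcoef n 0 s = 0"
| "Pcoef n (Suc 0) s = esym (2 * n) (2 * s - 1)"
| "Pcoef n (Suc (Suc r)) s =
     Pcoef n (Suc r) (s + 1) - esym (2 * n) (2 * s) * Pcoef n (Suc r) 1"

definition v :: "nat \<Rightarrow> nat \<Rightarrow> mpol poly" where
  "v n r = (\<Sum>s=1..n. monom (Pcoef n r (int s)) (2 * (s - 1)))"

definition w :: "nat \<Rightarrow> nat \<Rightarrow> mpol poly" where
  "w n r = [:0, 1:] * v n r"

definition v0 :: "nat \<Rightarrow> mpol poly" where
  "v0 n = (\<Sum>j=0..n. monom (esym (2 * n) (2 * int j)) (2 * j))"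

text \<open>
  The defining equation of \<open>\<xi>\<^sub>k\<close> with the denominator \<open>X\<^sub>1 + X\<^sub>2\<close> cleared; the lemma
  \<open>xi_ex1\<close> below shows that it has exactly one solution.
\<close>

definition is_xi :: "nat \<Rightarrow> nat \<Rightarrow> mpol poly poly \<Rightarrow> bool" where
  "is_xi n k Q \<longleftrightarrow>
     (X1 + X2) * (2 * Q) =
       (X1 - X2) * (in_X1 (v0 n) * in_X2 (w n k) + in_X2 (v0 n) * in_X1 (w n k))
       + (X1 + X2) * (- in_X1 (v0 n) * in_X2 (w n k) + in_X2 (v0 n) * in_X1 (w n k))"

definition xi :: "nat \<Rightarrow> nat \<Rightarrow> mpol poly poly" where
  "xi n k = (THE Q. is_xi n k Q)"

definition U2_basis :: "nat \<Rightarrow> mpol poly poly set" where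
  "U2_basis n =
     {wedge (v n i1) (v n i2) | i1 i2. 1 \<le> i1 \<and> i1 < i2 \<and> i2 \<le> n} \<union>
     {wedge (w n j1) (w n j2) | j1 j2. 1 \<le> j1 \<and> j1 < j2 \<and> j2 \<le> n} \<union>
     {wedge (v n i) (w n j) | i j. 1 \<le> i \<and> i \<le> n \<and> 1 \<le> j \<and> j \<le> n - 1} \<union>
     {xi n k | k. 1 \<le> k \<and> k \<le> n}"


subsection \<open>Existence and uniqueness of \<open>\<xi>\<^sub>k\<close>\<close>

lemma in_X1_0: "in_X1 0 = 0"
  by (simp add: in_X1_def)

lemma in_X1_add: "in_X1 (f + g) = in_X1 f + in_X1 g"
  by (intro poly_eqI) (simp add: in_X1_def coeff_map_poly)

lemma in_X1_sum: "in_X1 (\<Sum>i\<in>A. f i) = (\<Sum>i\<in>A. in_X1 (f i))"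
  by (induction A rule: infinite_finite_induct) (simp_all add: in_X1_0 in_X1_add)

lemma poly_in_X1_monom: "poly (in_X1 (monom c i)) (- [:0, 1:]) = (- 1) ^ i * monom c i"
proof -
  have "in_X1 (monom c i) = monom [:c:] i"
    by (intro poly_eqI) (simp add: in_X1_def coeff_map_poly)
  then have "poly (in_X1 (monom c i)) (- [:0, 1:]) = [:c:] * (- [:0, 1:]) ^ i"
    by (simp add: poly_monom)
  also have "\<dots> = (- 1) ^ i * ([:c:] * [:0, 1:] ^ i)"
    by (subst power_minus) (simp only: ac_simps)
  also have "[:c:] * [:0, 1:] ^ i = monom c i"
    by (simp add: monom_altdef)
  finally show ?thesis .
qed

lemma poly_in_X1_v0: "poly (in_X1 (v0 n)) (- [:0, 1:]) = v0 n"
  by (simp only: v0_def in_X1_sum poly_sum poly_in_X1_monom) simp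

lemma w_altdef: "w n r = (\<Sum>s=1..n. monom (Pcoef n r (int s)) (Suc (2 * (s - 1))))"
  unfolding w_def v_def sum_distrib_left by (intro sum.cong refl) (simp add: monom_Suc)

lemma poly_in_X1_w: "poly (in_X1 (w n r)) (- [:0, 1:]) = - w n r"
  by (simp only: w_altdef in_X1_sum poly_sum poly_in_X1_monom) (simp add: sum_negf)

lemma X1_plus_X2: "X1 + X2 = [:[:0, 1:], 1:]"
  by (simp add: X1_def X2_def)

lemma xi_ex1: "\<exists>!Q. is_xi n k Q"
proof -
  define S where "S = in_X1 (v0 n) * in_X2 (w n k) + in_X2 (v0 n) * in_X1 (w n k)"
  define D where "D = - in_X1 (v0 n) * in_X2 (w n k) + in_X2 (v0 n) * in_X1 (w n k)"
  define h where "h = [:[:Poly_Mapping.single 0 (1 / 2) :: mpol:]:]"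
  define T where "T = synthetic_div S (- [:0, 1:])"
  have "poly S (- [:0, 1:]) = 0"
    by (simp only: S_def poly_add poly_mult poly_in_X1_v0 poly_in_X1_w in_X2_def) simp
  then have S: "(X1 + X2) * T = S"
    using synthetic_div_correct'[of "- [:0, 1:]" S] by (simp add: T_def X1_plus_X2)
  have half: "2 * h = 1"
  proof -
    have "h + h = [:[:Poly_Mapping.single 0 (1 / 2) + Poly_Mapping.single 0 (1 / 2) :: mpol:]:]"
      unfolding h_def by simp
    also have "Poly_Mapping.single 0 (1 / 2) + Poly_Mapping.single 0 (1 / 2) = (1 :: mpol)"
      by (simp flip: single_add)
    finally show ?thesis
      by (simp only: mult_2 one_pCons)
  qed
  have "is_xi n k (h * ((X1 - X2) * T + D))"
  proof -
    have "a * (2 * (h * (b * T + D))) = (2 * h) * (b * (a * T) + a * D)" for a b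
      by (simp only: distrib_left ac_simps)
    from this [of "X1 + X2" "X1 - X2"]
    have "(X1 + X2) * (2 * (h * ((X1 - X2) * T + D))) =
        (2 * h) * ((X1 - X2) * ((X1 + X2) * T) + (X1 + X2) * D)" .
    then show ?thesis
      by (simp only: is_xi_def half S mult_1 S_def [symmetric] D_def [symmetric])
  qed
  moreover have "Q = Q'" if "is_xi n k Q" "is_xi n k Q'" for Q Q'
  proof -
    have "(X1 + X2) * (2 * Q) = (X1 + X2) * (2 * Q')"
      using that by (simp only: is_xi_def)
    moreover have "X1 + X2 \<noteq> 0"
      by (simp add: X1_plus_X2)
    ultimately have "2 * Q = 2 * Q'"
      by (simp only: mult_left_cancel not_False_eq_True)
    then have "h * (2 * Q) = h * (2 * Q')"
      by (rule arg_cong)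
    then have "(2 * h) * Q = (2 * h) * Q'"
      by (simp only: ac_simps)
    then show ?thesis by (simp only: half mult_1)
  qed
  ultimately show ?thesis by blast
qed

lemma xi_equation: "is_xi n k (xi n k)"
  unfolding xi_def by (rule theI' [OF xi_ex1])

end

(* The conditions defining U say that, as vectors indexed by the exponent s, the even and the odd
   part of every row of the coefficient matrix of P belong to the module V of those vectors f of
   symmetric polynomials for which the sum of f_s x^(-2s) vanishes at x = x_{2n-1} = -x_{2n}.  The
   vectors P_1, ..., P_n of the coefficients P_{r,s} lie in V, because the generating function of
   the elementary symmetric polynomials vanishes at 1/x and -1/x under this specialisation.
   The determinant of any n vectors in V vanishes when x_{2n-1} = -x_{2n}, so by symmetry it is
   divisible by the product D of all x_i + x_j (i < j).  The determinant of P_1, ..., P_n has the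
   degree of D and does not vanish identically, hence it is a nonzero multiple of D, and Cramer's
   rule shows that P_1, ..., P_n is a basis of V.

   Split the coefficient matrix of P into four n x n blocks by the parities of the exponents.  All
   rows and columns of a block lie in V.  The matrix G_k of xi_k is symmetric, and its row with
   number n + 1 - k involves P_n with coefficient -1, while the other rows do not involve P_n.
   Subtracting multiples of the G_k thus leaves a matrix whose rows are combinations of
   P_1, ..., P_{n-1}.  Since these n - 1 vectors stay independent under the specialisation, the
   coefficients in such a combination have columns in V, and the block is a combination of the G_k
   and of the products of P_i and P_j with j < n.  In the even-even and odd-odd blocks,
   antisymmetry cancels the symmetric G_k. *)
theory Submission
  imports Defs "Jordan_Normal_Form.Determinant"
    "HOL-Computational_Algebra.Fundamental_Theorem_Algebra"
begin

section \<open>Evaluation of polynomials at complex points, and its faithfulness\<close>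

abbreviation (input) ev :: "(nat \<Rightarrow> complex) \<Rightarrow> mpol \<Rightarrow> complex" where
  "ev \<equiv> eval_mpol"

definition mono_val :: "(nat \<Rightarrow> complex) \<Rightarrow> (nat \<Rightarrow>\<^sub>0 nat) \<Rightarrow> complex" where
  "mono_val a m = (\<Prod>i\<in>Poly_Mapping.keys m. a i ^ Poly_Mapping.lookup m i)"

lemma mono_val_superset:
  assumes "finite S" "Poly_Mapping.keys m \<subseteq> S"
  shows "mono_val a m = (\<Prod>i\<in>S. a i ^ Poly_Mapping.lookup m i)"
  unfolding mono_val_def using assms
  by (intro prod.mono_neutral_left) (auto simp: in_keys_iff)

lemma mono_val_0 [simp]: "mono_val a 0 = 1"
  by (simp add: mono_val_def)

lemma mono_val_add: "mono_val a (m + m') = mono_val a m * mono_val a m'"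
proof -
  let ?S = "Poly_Mapping.keys m \<union> Poly_Mapping.keys m'"
  have "Poly_Mapping.keys (m + m') \<subseteq> ?S" by (rule keys_add)
  then show ?thesis
    by (simp add: mono_val_superset[of ?S] lookup_add power_add prod.distrib)
qed

lemma mono_val_mult: "mono_val (\<lambda>i. a i * b i) m = mono_val a m * mono_val b m"
  by (simp add: mono_val_def power_mult_distrib prod.distrib)

lemma mono_val_one [simp]: "mono_val (\<lambda>i. 1) m = 1"
  by (simp add: mono_val_def)

lemma mono_val_single: "mono_val a (Poly_Mapping.single i k) = a i ^ k"
  by (subst mono_val_superset[of "{i}"]) auto

text \<open>The powers of 2 are distinct, so this point reads off the exponent of a single variable;
  it is the test point for separating monomials.\<close>

lemma mono_val_two: "mono_val ((\<lambda>_. 1)(i := 2)) m = 2 ^ Poly_Mapping.lookup m i"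
  by (subst mono_val_superset[of "insert i (Poly_Mapping.keys m)"])
     (auto simp: prod.insert_remove intro!: prod.neutral)

lemma ev_superset:
  assumes "finite S" "Poly_Mapping.keys p \<subseteq> S"
  shows "ev a p = (\<Sum>m\<in>S. Poly_Mapping.lookup p m * mono_val a m)"
  unfolding eval_mpol_def mono_val_def[symmetric] using assms
  by (intro sum.mono_neutral_left) (auto simp: in_keys_iff)

lemma ev_0 [simp]: "ev a 0 = 0"
  by (simp add: eval_mpol_def)

lemma ev_single: "ev a (Poly_Mapping.single m c) = c * mono_val a m"
  by (subst ev_superset[of "{m}"]) auto

lemma ev_1 [simp]: "ev a 1 = 1"
  using ev_single[of a 0 1] by simp

lemma ev_xvar [simp]: "ev a (xvar i) = a i"
  by (simp add: xvar_def ev_single mono_val_single)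

lemma ev_add [simp]: "ev a (p + q) = ev a p + ev a q"
proof -
  let ?S = "Poly_Mapping.keys p \<union> Poly_Mapping.keys q"
  have "Poly_Mapping.keys (p + q) \<subseteq> ?S" by (rule keys_add)
  then show ?thesis
    by (simp add: ev_superset[of ?S] lookup_add distrib_right sum.distrib)
qed

lemma ev_minus [simp]: "ev a (- p) = - ev a p"
  using ev_add[of a p "- p"] by (simp add: add_eq_0_iff2 del: ev_add)

lemma ev_diff [simp]: "ev a (p - q) = ev a p - ev a q"
  using ev_add[of a p "- q"] by (simp del: ev_add)

lemma ev_sum [simp]: "ev a (sum f I) = (\<Sum>i\<in>I. ev a (f i))"
  by (induction I rule: infinite_finite_induct) auto

lemma mpol_as_sum: 
  "p = (\<Sum>m\<in>Poly_Mapping.keys p. Poly_Mapping.single m (Poly_Mapping.lookup p m))"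
  by (rule poly_mapping_eqI)
     (auto simp: lookup_sum lookup_single when_def in_keys_iff sum.delta)

lemma ev_mult [simp]: "ev a (p * q) = ev a p * ev a q"
proof -
  have "ev a (p * q) = ev a ((\<Sum>m\<in>Poly_Mapping.keys p. Poly_Mapping.single m (Poly_Mapping.lookup p m)) *
     (\<Sum>m\<in>Poly_Mapping.keys q. Poly_Mapping.single m (Poly_Mapping.lookup q m)))"
    by (rule arg_cong[OF arg_cong2[OF mpol_as_sum mpol_as_sum]])
  also have "\<dots> = ev a p * ev a q"
    by (simp add: sum_product mult_single ev_single mono_val_add
        ev_superset[OF finite_keys order_refl, of a p] ev_superset[OF finite_keys order_refl, of a q] mult_ac)
  finally show ?thesis .
qed

lemma ev_power [simp]: "ev a (p ^ k) = ev a p ^ k"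
  by (induction k) auto

lemma ev_prod [simp]: "ev a (prod f I) = (\<Prod>i\<in>I. ev a (f i))"
  by (induction I rule: infinite_finite_induct) auto

lemma ev_numeral [simp]: "ev a (of_int k) = of_int k"
proof -
  have n: "ev a (of_nat k) = of_nat k" for k by (induction k) auto
  then show ?thesis by (cases k) (auto)
qed

text \<open>Dedekind's argument: distinct characters of the monoid of evaluation points are
  linearly independent.\<close>

lemma mono_val_independent:
  assumes "finite S" "\<And>a. (\<Sum>m\<in>S. c m * mono_val a m) = 0" "m \<in> S"
  shows "c m = 0"
  using assms
proof (induction S arbitrary: c m rule: finite_induct)
  case (insert m0 S)
  have zero: "c m1 = 0" if m1: "m1 \<in> S" for m1
  proof -
    from m1 insert have "m1 \<noteq> m0" by auto
    then obtain i where i: "Poly_Mapping.lookup m1 i \<noteq> Poly_Mapping.lookup m0 i"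
      by (metis poly_mapping_eqI)
    define b :: "nat \<Rightarrow> complex" where "b = (\<lambda>_. 1)(i := 2)"
    have "(2::complex) ^ Poly_Mapping.lookup m1 i \<noteq> 2 ^ Poly_Mapping.lookup m0 i"
    proof
      assume "(2::complex) ^ Poly_Mapping.lookup m1 i = 2 ^ Poly_Mapping.lookup m0 i"
      then have "norm ((2::complex) ^ Poly_Mapping.lookup m1 i) = norm ((2::complex) ^ Poly_Mapping.lookup m0 i)" by simp
      with i show False by (simp add: norm_power)
    qed
    then have ne: "mono_val b m1 \<noteq> mono_val b m0"
      by (simp add: b_def mono_val_two)
    \<comment> \<open>Subtracting \<open>mono_val b m0\<close> times the relation at
      \<open>a\<close> from the relation at the product of \<open>a\<close> and \<open>b\<close>
      cancels the term of \<open>m0\<close>.\<close>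
    have "(\<Sum>m\<in>S. (c m * (mono_val b m - mono_val b m0)) * mono_val a m) = 0" for a
    proof -
      have "(\<Sum>m\<in>insert m0 S. c m * mono_val (\<lambda>i. a i * b i) m)
          - mono_val b m0 * (\<Sum>m\<in>insert m0 S. c m * mono_val a m) = 0"
        using insert.prems(1) by simp
      then show ?thesis using insert.hyps
        by (simp add: mono_val_mult algebra_simps sum_distrib_left flip: sum_subtractf)
    qed
    from insert.IH[OF this m1] ne show ?thesis by simp
  qed
  with insert.prems(1)[of "\<lambda>_. 1"] insert.hyps have "c m0 = 0" by simp
  with zero insert.prems show ?case by auto
qed simp

text \<open>The monomial functions are linearly independent, so a polynomial is determined by its
  values. Polynomial identities below are reduced to identities between complex numbers in this
  way.\<close>

lemma ev_inject: 
  assumes "\<And>a. ev a p = ev a q" shows "p = q"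
proof -
  have "Poly_Mapping.lookup (p - q) m = 0" for m
  proof (cases "m \<in> Poly_Mapping.keys (p - q)")
    case True
    have "(\<Sum>m\<in>Poly_Mapping.keys (p - q). Poly_Mapping.lookup (p - q) m * mono_val a m) = 0" for a
      using assms by (simp flip: ev_superset)
    from mono_val_independent[OF finite_keys this True] show ?thesis .
  qed (simp add: in_keys_iff)
  then have "p - q = 0" by (intro poly_mapping_eqI) simp
  then show ?thesis by simp
qed

subsection \<open>Substitution\<close>

definition const :: "complex \<Rightarrow> mpol" where "const c = Poly_Mapping.single 0 c"

lemma ev_const [simp]: "ev a (const c) = c"
  by (simp add: const_def ev_single)

definition subst :: "(nat \<Rightarrow> mpol) \<Rightarrow> mpol \<Rightarrow> mpol" where
  "subst f p = (\<Sum>m\<in>Poly_Mapping.keys p. const (Poly_Mapping.lookup p m) *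
     (\<Prod>i\<in>Poly_Mapping.keys m. f i ^ Poly_Mapping.lookup m i))"

text \<open>Evaluation after substitution is evaluation at a moved point; with
  \<open>ev_inject\<close> this yields the homomorphism laws of \<open>subst\<close> without any
  work on monomials.\<close>

lemma ev_subst [simp]: "ev a (subst f p) = ev (\<lambda>i. ev a (f i)) p"
  by (simp add: subst_def) (simp add: eval_mpol_def)

lemma subst_xvar [simp]: "subst xvar p = p"
  by (rule ev_inject) simp

lemma subst_hom [simp]:
  "subst f (p + q) = subst f p + subst f q" "subst f (p * q) = subst f p * subst f q"
  "subst f 0 = 0" "subst f 1 = 1" "subst f (xvar i) = f i" "subst f (p - q) = subst f p - subst f q"
  "subst f (- p) = - subst f p" "subst f (p ^ k) = subst f p ^ k"
  by (rule ev_inject; simp)+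

lemma subst_sum [simp]: "subst f (sum g I) = (\<Sum>i\<in>I. subst f (g i))"
  by (rule ev_inject) simp

lemma dvd_prod_diff:
  fixes d :: "'a::comm_ring_1"
  assumes "\<And>i. i \<in> I \<Longrightarrow> d dvd f i - g i"
  shows "d dvd prod f I - prod g I"
  using assms
proof (induction I rule: infinite_finite_induct)
  case (insert i I)
  have "f i * prod f I - g i * prod g I = f i * (prod f I - prod g I) + (f i - g i) * prod g I"
    by (simp add: algebra_simps)
  with insert show ?case by (auto intro!: dvd_add dvd_mult dvd_mult2)
qed auto

text \<open>Congruences modulo \<open>d\<close> are preserved by sums, products and powers, hence by
  any polynomial expression. This is the source of the factor theorem below.\<close>

lemma dvd_subst_diff:
  assumes "\<And>i. d dvd f i - g i"
  shows "d dvd subst f p - subst g p"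
proof -
  have "d dvd f i ^ k - g i ^ k" for i k
    using dvd_prod_diff[of "{..<k}" d "\<lambda>_. f i" "\<lambda>_. g i"] assms by simp
  then show ?thesis
    unfolding subst_def sum_subtractf[symmetric] right_diff_distrib[symmetric]
    by (intro dvd_sum dvd_mult dvd_prod_diff)
qed

subsection \<open>Symmetric polynomials\<close>

lemma lookup_map_key_perm:
  assumes "\<pi> permutes S"
  shows "Poly_Mapping.lookup (Poly_Mapping.map_key \<pi> m) i = Poly_Mapping.lookup m (\<pi> i)"
  using permutes_inj[OF assms] by (simp add: map_key.rep_eq)

lemma keys_map_key_perm:
  assumes "\<pi> permutes S"
  shows "Poly_Mapping.keys (Poly_Mapping.map_key \<pi> m) = \<pi> -` Poly_Mapping.keys m"
  by (auto simp: in_keys_iff lookup_map_key_perm[OF assms])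

lemma mono_val_map_key:
  assumes "\<pi> permutes S"
  shows "mono_val (a \<circ> \<pi>) (Poly_Mapping.map_key \<pi> m) = mono_val a m"
proof -
  have "Poly_Mapping.keys m = \<pi> ` (\<pi> -` Poly_Mapping.keys m)"
    using permutes_surj[OF assms] by (simp add: surj_image_vimage_eq)
  moreover have "inj_on \<pi> (\<pi> -` Poly_Mapping.keys m)"
    using permutes_inj[OF assms] inj_on_subset by blast
  ultimately have "mono_val a m =
      (\<Prod>i\<in>\<pi> -` Poly_Mapping.keys m. a (\<pi> i) ^ Poly_Mapping.lookup m (\<pi> i))"
    unfolding mono_val_def by (metis (mono_tags, lifting) prod.reindex_cong)
  then show ?thesis
    by (simp add: mono_val_def lookup_map_key_perm[OF assms] keys_map_key_perm[OF assms])
qed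

lemma map_key_perm_bij:
  assumes "\<pi> permutes S"
  shows "Poly_Mapping.map_key \<pi> (Poly_Mapping.map_key (inv_into UNIV \<pi>) m) = m"
    "Poly_Mapping.map_key (inv_into UNIV \<pi>) (Poly_Mapping.map_key \<pi> m) = m"
  by (rule poly_mapping_eqI; 
      simp add: lookup_map_key_perm[OF assms] lookup_map_key_perm[OF permutes_inv[OF assms]]
      permutes_inverses[OF assms])+

text \<open>Translates the conditions on the coefficients into conditions on the values: no
  dependence on variables outside the range, and invariance under permutations of the point. The
  ring closure properties are then immediate.\<close>

lemma sym_ring_iff:
  "p \<in> sym_ring N \<longleftrightarrow> 
    (\<forall>a b. (\<forall>i\<in>{1..N}. a i = b i) \<longrightarrow> ev a p = ev b p) \<and>
    (\<forall>\<pi> a. \<pi> permutes {1..N} \<longrightarrow> ev (a \<circ> \<pi>) p = ev a p)" (is "_ \<longleftrightarrow> ?A \<and> ?B")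
proof
  assume p: "p \<in> sym_ring N"
  have ?A
  proof (intro allI impI)
    fix a b :: "nat \<Rightarrow> complex" assume ab: "\<forall>i\<in>{1..N}. a i = b i"
    have "a i = b i" if "m \<in> Poly_Mapping.keys p" "i \<in> Poly_Mapping.keys m" for m i
    proof -
      have "Poly_Mapping.keys m \<subseteq> {1..N}" using p that(1) unfolding sym_ring_def by blast
      with ab that(2) show ?thesis by blast
    qed
    then show "ev a p = ev b p"
      unfolding eval_mpol_def by (intro sum.cong prod.cong refl arg_cong2[of _ _ _ _ "(*)"]) auto
  qed
  moreover have ?B
  proof (intro allI impI)
    fix \<pi> and a :: "nat \<Rightarrow> complex" assume pi: "\<pi> permutes {1..N}"
    let ?f = "Poly_Mapping.map_key \<pi> :: (nat \<Rightarrow>\<^sub>0 nat) \<Rightarrow> _"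
    have l: "Poly_Mapping.lookup p (?f m) = Poly_Mapping.lookup p m" for m
      using p pi by (auto simp: sym_ring_def)
    have inj: "inj ?f" using map_key_perm_bij(2)[OF pi] by (metis injI)
    have img: "?f ` Poly_Mapping.keys p = Poly_Mapping.keys p"
    proof (rule card_subset_eq)
      show "?f ` Poly_Mapping.keys p \<subseteq> Poly_Mapping.keys p" using l by (auto simp: in_keys_iff)
    qed (simp_all add: card_image inj_on_subset[OF inj subset_UNIV])
    have "ev (a \<circ> \<pi>) p = (\<Sum>m\<in>?f ` Poly_Mapping.keys p. Poly_Mapping.lookup p m * mono_val (a \<circ> \<pi>) m)"
      by (simp add: img flip: ev_superset)
    also have "\<dots> = (\<Sum>m\<in>Poly_Mapping.keys p. Poly_Mapping.lookup p m * mono_val a m)"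
      by (subst sum.reindex) (auto simp: inj_on_subset[OF inj subset_UNIV] l mono_val_map_key[OF pi])
    finally show "ev (a \<circ> \<pi>) p = ev a p" by (simp flip: ev_superset)
  qed
  ultimately show "?A \<and> ?B" ..
next
  assume AB: "?A \<and> ?B"
  have "i \<in> {1..N}" if m: "m \<in> Poly_Mapping.keys p" and i: "i \<in> Poly_Mapping.keys m" for m i
  proof (rule ccontr)
    assume "i \<notin> {1..N}"
    \<comment> \<open>Doubling the coordinate \<open>i\<close> leaves all values unchanged but
      multiplies each monomial by a power of 2; by independence this power is 1 on the
      support.\<close>
    define b :: "nat \<Rightarrow> complex" where "b = (\<lambda>_. 1)(i := 2)"
    have "(\<Sum>m\<in>Poly_Mapping.keys p. (Poly_Mapping.lookup p m * (mono_val b m - 1)) * mono_val a m) = 0" for a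
    proof -
      have "ev (\<lambda>i. a i * b i) p = ev a p"
        using AB \<open>i \<notin> {1..N}\<close> by (auto simp: b_def)
      then show ?thesis
        by (simp add: ev_superset[OF finite_keys order_refl] mono_val_mult algebra_simps sum_subtractf)
    qed
    from mono_val_independent[OF finite_keys this m] m have "mono_val b m = 1"
      by (auto simp: in_keys_iff)
    then have "(2::complex) ^ Poly_Mapping.lookup m i = 1" by (simp add: b_def mono_val_two)
    then have "norm ((2::complex) ^ Poly_Mapping.lookup m i) = 1" by simp
    then have "(2::real) ^ Poly_Mapping.lookup m i = 1" by (simp add: norm_power)
    with i one_less_power[of "2::real" "Poly_Mapping.lookup m i"] show False
      by (simp add: in_keys_iff)
  qed
  moreover have "Poly_Mapping.lookup p (Poly_Mapping.map_key \<pi> m0) = Poly_Mapping.lookup p m0"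
    if pi: "\<pi> permutes {1..N}" for \<pi> m0
  proof -
    let ?f = "Poly_Mapping.map_key \<pi> :: (nat \<Rightarrow>\<^sub>0 nat) \<Rightarrow> _"
    let ?g = "Poly_Mapping.map_key (inv_into UNIV \<pi>) :: (nat \<Rightarrow>\<^sub>0 nat) \<Rightarrow> _"
    have inj: "inj ?f" using map_key_perm_bij(2)[OF pi] by (metis injI)
    \<comment> \<open>\<open>S\<close> contains \<open>m0\<close>, the support of \<open>p\<close>
      and the preimage of that support under \<open>?f\<close>, so both sums over \<open>S\<close>
      catch all nonzero terms.\<close>
    define S where "S = insert m0 (Poly_Mapping.keys p \<union> ?g ` Poly_Mapping.keys p)"
    have fin: "finite S" by (simp add: S_def)
    have "(\<Sum>m\<in>S. (Poly_Mapping.lookup p (?f m) - Poly_Mapping.lookup p m) * mono_val a m) = 0" for a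
    proof -
      have "Poly_Mapping.keys p \<subseteq> ?f ` S"
      proof
        fix m assume m: "m \<in> Poly_Mapping.keys p"
        then have "?g m \<in> S" by (simp add: S_def)
        then have "?f (?g m) \<in> ?f ` S" by (rule imageI)
        then show "m \<in> ?f ` S" by (simp add: map_key_perm_bij[OF pi])
      qed
      then have "ev (a \<circ> \<pi>) p = (\<Sum>m\<in>?f ` S. Poly_Mapping.lookup p m * mono_val (a \<circ> \<pi>) m)"
        using fin by (intro ev_superset) auto
      also have "\<dots> = (\<Sum>m\<in>S. Poly_Mapping.lookup p (?f m) * mono_val a m)"
        by (subst sum.reindex) (auto simp: inj_on_subset[OF inj subset_UNIV] mono_val_map_key[OF pi])
      finally have "(\<Sum>m\<in>S. Poly_Mapping.lookup p (?f m) * mono_val a m) = ev a p"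
        using AB pi by simp
      also have "\<dots> = (\<Sum>m\<in>S. Poly_Mapping.lookup p m * mono_val a m)"
        using fin by (intro ev_superset) (auto simp: S_def)
      finally show ?thesis by (simp add: algebra_simps sum_subtractf)
    qed
    from mono_val_independent[OF fin this, of m0] show ?thesis by (simp add: S_def)
  qed
  ultimately show "p \<in> sym_ring N" unfolding sym_ring_def by blast
qed

lemma sym_ring_evD:
  assumes "p \<in> sym_ring N"
  shows "(\<And>i. i \<in> {1..N} \<Longrightarrow> a i = b i) \<Longrightarrow> ev a p = ev b p"
    and "\<pi> permutes {1..N} \<Longrightarrow> ev (a \<circ> \<pi>) p = ev a p"
  using assms unfolding sym_ring_iff by blast+

lemma sym_ringI:
  assumes "\<And>a b. (\<And>i. i \<in> {1..N} \<Longrightarrow> a i = b i) \<Longrightarrow> ev a p = ev b p"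
    and "\<And>\<pi> a. \<pi> permutes {1..N} \<Longrightarrow> ev (a \<circ> \<pi>) p = ev a p"
  shows "p \<in> sym_ring N"
  unfolding sym_ring_iff using assms by blast

lemma sym_ring_const [simp, intro]: "const c \<in> sym_ring N" "0 \<in> sym_ring N" "1 \<in> sym_ring N"
  by (rule sym_ringI; simp)+

lemma sym_ring_add [intro]: "p \<in> sym_ring N \<Longrightarrow> q \<in> sym_ring N \<Longrightarrow> p + q \<in> sym_ring N"
  unfolding sym_ring_iff ev_add by (intro conjI allI impI arg_cong2[of _ _ _ _ "(+)"]) blast+

lemma sym_ring_mult [intro]: "p \<in> sym_ring N \<Longrightarrow> q \<in> sym_ring N \<Longrightarrow> p * q \<in> sym_ring N"
  unfolding sym_ring_iff ev_mult by (intro conjI allI impI arg_cong2[of _ _ _ _ "(*)"]) blast+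

lemma sym_ring_minus [intro]: "p \<in> sym_ring N \<Longrightarrow> - p \<in> sym_ring N"
  unfolding sym_ring_iff ev_minus by (intro conjI allI impI arg_cong[of _ _ uminus]) blast+

lemma sym_ring_diff [intro]: "p \<in> sym_ring N \<Longrightarrow> q \<in> sym_ring N \<Longrightarrow> p - q \<in> sym_ring N"
  using sym_ring_add[of p N "- q"] sym_ring_minus[of q N] by simp

lemma sym_ring_sum [intro]: "(\<And>i. i \<in> I \<Longrightarrow> f i \<in> sym_ring N) \<Longrightarrow> sum f I \<in> sym_ring N"
  by (induction I rule: infinite_finite_induct) auto

lemma sym_ring_prod [intro]: "(\<And>i. i \<in> I \<Longrightarrow> f i \<in> sym_ring N) \<Longrightarrow> prod f I \<in> sym_ring N"
  by (induction I rule: infinite_finite_induct) auto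


section \<open>Divisibility by the product of all sums of two variables\<close>

text \<open>Replacing the variable i by minus the variable j turns \<open>p\<close> into 0, but
  changes it only by a multiple of the sum of the two variables.\<close>

lemma linear_dvd_of_vanishing:
  assumes "i \<noteq> j" "\<And>a. a i = - a j \<Longrightarrow> ev a p = 0"
  shows "xvar i + xvar j dvd p"
proof -
  define f where "f = xvar(i := - xvar j)"
  have "subst f p = 0"
    using assms by (intro ev_inject) (simp add: f_def)
  moreover have "xvar i + xvar j dvd xvar k - f k" for k
    by (simp add: f_def)
  then have "xvar i + xvar j dvd subst xvar p - subst f p"
    by (rule dvd_subst_diff)
  ultimately show ?thesis by simp
qed

definition pairs :: "nat \<Rightarrow> nat set set" where
  "pairs N = {A. A \<subseteq> {1..N} \<and> card A = 2}"

text \<open>This is the product D. Unordered pairs make its invariance under permutations a mere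
  reindexing.\<close>

definition sum_prod :: "nat \<Rightarrow> mpol" where
  "sum_prod N = (\<Prod>A\<in>pairs N. \<Sum>i\<in>A. xvar i)"

lemma finite_pairs [simp]: "finite (pairs N)"
  by (rule finite_subset[of _ "Pow {1..N}"]) (auto simp: pairs_def)

lemma card_pairs: "card (pairs N) = N choose 2"
  using n_subsets[of "{1..N}" 2] by (simp add: pairs_def)

text \<open>The factors are removed one at a time. On the hyperplane of a new factor the product of
  the old ones is not identically zero, so the quotient must vanish there and takes up the new
  factor.\<close>

lemma prod_linear_dvd_of_vanishing:
  assumes "finite S" "\<And>A. A \<in> S \<Longrightarrow> card A = 2"
    and "\<And>A a. A \<in> S \<Longrightarrow> (\<Sum>i\<in>A. a i) = 0 \<Longrightarrow> ev a p = 0"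
  shows "(\<Prod>A\<in>S. \<Sum>i\<in>A. xvar i) dvd p"
  using assms
proof (induction S rule: finite_induct)
  case (insert A S)
  obtain i j where A: "A = {i, j}" and ij: "i \<noteq> j"
    using insert.prems(1)[of A] by (auto simp: card_2_iff)
  let ?P = "\<Prod>A\<in>S. \<Sum>i\<in>A. xvar i"
  from insert have "?P dvd p" by blast
  then obtain q where q: "p = ?P * q" by (elim dvdE)
  define f where "f = xvar(i := - xvar j)"
  \<comment> \<open>The coordinates other than \<open>i\<close> are distinct and positive and that
    of \<open>i\<close> is minus that of \<open>j\<close>, so \<open>{i, j}\<close> is the only pair
    with sum zero.\<close>
  define b :: "nat \<Rightarrow> complex" where "b = (\<lambda>k. of_nat (Suc k))(i := - of_nat (Suc j))"
  have bf: "ev b (f k) = b k" for k using ij by (auto simp: f_def b_def)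
  have b_ne: "(\<Sum>k\<in>B. b k) \<noteq> 0" if B: "B \<in> S" for B
  proof (cases "i \<in> B")
    case True
    obtain l where l: "B = {i, l}" "l \<noteq> i"
      using insert.prems(1)[of B] B True by (auto simp: card_2_iff)
    with B insert.hyps A have "l \<noteq> j" by auto
    have "(\<Sum>k\<in>B. b k) = of_nat (Suc l) - of_nat (Suc j)" using l by (simp add: b_def)
    with \<open>l \<noteq> j\<close> show ?thesis by (simp del: of_nat_Suc)
  next
    case False
    obtain k l where kl: "B = {k, l}" "k \<noteq> l"
      using insert.prems(1)[of B] B by (auto simp: card_2_iff)
    with False have "(\<Sum>k\<in>B. b k) = of_nat (Suc k + Suc l)" by (simp add: b_def)
    also have "\<dots> \<noteq> 0" unfolding of_nat_eq_0_iff by simp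
    finally show ?thesis .
  qed
  have "subst f p = 0"
    using insert.prems(2)[of A] ij by (intro ev_inject) (simp add: f_def A)
  then have "subst f ?P * subst f q = 0" by (simp add: q)
  moreover have "ev b (subst f ?P) \<noteq> 0"
    using insert.hyps(1) b_ne by (simp add: bf)
  then have "subst f ?P \<noteq> 0" by (metis ev_0)
  ultimately have sq: "subst f q = 0" by simp
  have "xvar i + xvar j dvd q"
  proof (rule linear_dvd_of_vanishing[OF ij])
    fix a :: "nat \<Rightarrow> complex" assume "a i = - a j"
    then have "(\<lambda>k. ev a (f k)) = a" by (auto simp: f_def)
    with sq show "ev a q = 0" by (metis ev_subst ev_0)
  qed
  then have "?P * (xvar i + xvar j) dvd p" unfolding q by (rule mult_dvd_mono[OF dvd_refl])
  then show ?case using insert.hyps ij by (simp add: A mult.commute)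
qed simp

lemma ev_sum_prod: "ev a (sum_prod N) = (\<Prod>A\<in>pairs N. \<Sum>i\<in>A. a i)"
  by (simp add: sum_prod_def)

lemma sum_prod_nonzero [simp]: "sum_prod N \<noteq> 0"
proof -
  have "ev (\<lambda>_. 1) (sum_prod N) \<noteq> 0" by (simp add: ev_sum_prod) (simp add: pairs_def)
  then show ?thesis by auto
qed

lemma bij_betw_image_subsets:
  assumes "\<pi> permutes S"
  shows "bij_betw (image \<pi>) {A. A \<subseteq> S \<and> card A = k} {A. A \<subseteq> S \<and> card A = k}"
proof (rule bij_betw_byWitness[where f' = "image (inv_into UNIV \<pi>)"])
  have inj: "inj_on \<pi> A" "inj_on (inv_into UNIV \<pi>) A" for A
    using permutes_inj_on[OF assms] permutes_inj_on[OF permutes_inv[OF assms]] by auto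
  show "\<forall>A\<in>{A. A \<subseteq> S \<and> card A = k}. inv_into UNIV \<pi> ` \<pi> ` A = A"
    "\<forall>A\<in>{A. A \<subseteq> S \<and> card A = k}. \<pi> ` inv_into UNIV \<pi> ` A = A"
    by (auto simp: image_image permutes_inverses[OF assms])
  show "image \<pi> ` {A. A \<subseteq> S \<and> card A = k} \<subseteq> {A. A \<subseteq> S \<and> card A = k}"
    using permutes_image[OF assms] by (auto simp: card_image[OF inj(1)])
  show "image (inv_into UNIV \<pi>) ` {A. A \<subseteq> S \<and> card A = k} \<subseteq> {A. A \<subseteq> S \<and> card A = k}"
    using permutes_image[OF permutes_inv[OF assms]] by (auto simp: card_image[OF inj(2)])
qed

lemma sum_prod_sym [intro, simp]: "sum_prod N \<in> sym_ring N"
proof (rule sym_ringI)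
  fix a b :: "nat \<Rightarrow> complex" assume "\<And>i. i \<in> {1..N} \<Longrightarrow> a i = b i"
  then show "ev a (sum_prod N) = ev b (sum_prod N)"
    unfolding ev_sum_prod by (intro prod.cong sum.cong refl) (auto simp: pairs_def)
next
  fix \<pi> and a :: "nat \<Rightarrow> complex" assume pi: "\<pi> permutes {1..N}"
  have "ev (a \<circ> \<pi>) (sum_prod N) = (\<Prod>A\<in>pairs N. \<Sum>i\<in>\<pi> ` A. a i)"
    unfolding ev_sum_prod by (simp add: sum.reindex[OF permutes_inj_on[OF pi]])
  also have "\<dots> = ev a (sum_prod N)"
    unfolding ev_sum_prod
    using bij_betw_image_subsets[OF pi, of 2] unfolding pairs_def[symmetric]
    by (rule prod.reindex_bij_betw)
  finally show "ev (a \<circ> \<pi>) (sum_prod N) = ev a (sum_prod N)" .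
qed

text \<open>Permuting the variables of \<open>q\<close>, or setting those outside the range to 0,
  does not change its product with \<open>d\<close>. Since there are no zero divisors, it does not
  change \<open>q\<close> either.\<close>

lemma sym_ring_cancel:
  assumes "d * q \<in> sym_ring N" "d \<in> sym_ring N" "d \<noteq> 0"
  shows "q \<in> sym_ring N"
proof (rule sym_ringI)
  fix \<pi> and a :: "nat \<Rightarrow> complex" assume pi: "\<pi> permutes {1..N}"
  define r where "r = subst (\<lambda>i. xvar (\<pi> i)) q"
  have r: "ev a r = ev (a \<circ> \<pi>) q" for a by (simp add: r_def comp_def)
  have "ev a (d * r) = ev a (d * q)" for a
    using sym_ring_evD(2)[OF assms(1) pi, of a] sym_ring_evD(2)[OF assms(2) pi, of a]
    by (simp add: r)
  then have "d * r = d * q" by (rule ev_inject)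
  with assms(3) have "r = q" by simp
  with r show "ev (a \<circ> \<pi>) q = ev a q" by simp
next
  fix a b :: "nat \<Rightarrow> complex" assume ab: "\<And>i. i \<in> {1..N} \<Longrightarrow> a i = b i"
  define cut :: "(nat \<Rightarrow> complex) \<Rightarrow> nat \<Rightarrow> complex" where "cut a i = (if i \<in> {1..N} then a i else 0)" for a i
  define r where "r = subst (\<lambda>i. if i \<in> {1..N} then xvar i else 0) q"
  have r: "ev a r = ev (cut a) q" for a
    by (simp add: r_def cut_def[abs_def] if_distrib cong: if_cong)
  have "ev a (d * r) = ev a (d * q)" for a
    using sym_ring_evD(1)[OF assms(1), of a "cut a"] sym_ring_evD(1)[OF assms(2), of a "cut a"]
    by (auto simp: r cut_def)
  then have "d * r = d * q" by (rule ev_inject)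
  with assms(3) have "r = q" by simp
  moreover have "cut a = cut b" using ab by (auto simp: cut_def)
  ultimately show "ev a q = ev b q" using r by metis
qed

text \<open>Symmetry transports the vanishing for the last two variables to every pair of
  variables.\<close>

lemma sum_prod_dvd:
  assumes "N \<ge> 2" "p \<in> sym_ring N" "\<And>a. a N = - a (N - 1) \<Longrightarrow> ev a p = 0"
  obtains q where "q \<in> sym_ring N" "p = sum_prod N * q"
proof -
  have "ev a p = 0" if A: "A \<in> pairs N" and a: "(\<Sum>i\<in>A. a i) = 0" for A a
  proof -
    from A obtain i j where ij: "A = {i, j}" "i \<noteq> j" "i \<in> {1..N}" "j \<in> {1..N}"
      by (auto simp: pairs_def card_2_iff)
    \<comment> \<open>\<open>k\<close> is the preimage of \<open>i\<close> under the outer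
      transposition, so that \<open>\<pi>\<close> sends N - 1 to \<open>i\<close> and N to
      \<open>j\<close>.\<close>
    define k where "k = transpose N j i"
    define \<pi> where "\<pi> = transpose N j \<circ> transpose (N - 1) k"
    have "k \<noteq> N" using ij by (auto simp: k_def transpose_def)
    then have pi_vals: "\<pi> N = j" "\<pi> (N - 1) = i"
      using assms(1) by (auto simp: \<pi>_def k_def)
    have pi: "\<pi> permutes {1..N}"
      unfolding \<pi>_def using ij assms(1) 
      by (intro permutes_compose permutes_swap_id) (auto simp: k_def transpose_def)
    have "ev (a \<circ> \<pi>) p = 0"
      by (rule assms(3)) (use a ij in \<open>simp add: pi_vals pi_vals(2)[simplified] add_eq_0_iff2\<close>)
    then show ?thesis using sym_ring_evD(2)[OF assms(2) pi] by simp
  qed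
  then have "sum_prod N dvd p"
    unfolding sum_prod_def by (intro prod_linear_dvd_of_vanishing) (auto simp: pairs_def)
  then obtain q where "p = sum_prod N * q" by (elim dvdE)
  moreover from this have "q \<in> sym_ring N"
    using sym_ring_cancel[of "sum_prod N" q N] assms(2) by simp
  ultimately show ?thesis using that by blast
qed

subsection \<open>Elementary symmetric polynomials\<close>

lemma ev_esym: "ev a (esym N (int k)) = (\<Sum>A | A \<subseteq> {1..N} \<and> card A = k. \<Prod>i\<in>A. a i)"
  by (simp add: esym_def)

lemma esym_sym [intro, simp]: "esym N k \<in> sym_ring N"
proof (cases "k < 0")
  case False
  then obtain m where k: "k = int m" using nonneg_int_cases not_le by blast
  show ?thesis unfolding k
  proof (rule sym_ringI)
    fix a b :: "nat \<Rightarrow> complex" assume "\<And>i. i \<in> {1..N} \<Longrightarrow> a i = b i"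
    then show "ev a (esym N (int m)) = ev b (esym N (int m))"
      unfolding ev_esym by (intro prod.cong sum.cong refl) auto
  next
    fix \<pi> and a :: "nat \<Rightarrow> complex" assume pi: "\<pi> permutes {1..N}"
    have "ev (a \<circ> \<pi>) (esym N (int m)) = (\<Sum>A | A \<subseteq> {1..N} \<and> card A = m. \<Prod>i\<in>\<pi> ` A. a i)"
      unfolding ev_esym by (simp add: prod.reindex[OF permutes_inj_on[OF pi]])
    also have "\<dots> = ev a (esym N (int m))"
      unfolding ev_esym
      using bij_betw_image_subsets[OF pi] by (rule sum.reindex_bij_betw)
    finally show "ev (a \<circ> \<pi>) (esym N (int m)) = ev a (esym N (int m))" .
  qed
qed (simp add: esym_def)

lemma esym_large [simp]:
  assumes "k > int N"
  shows "esym N k = 0"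
proof -
  have "A \<notin> {A. A \<subseteq> {1..N} \<and> card A = nat k}" for A
  proof
    assume "A \<in> {A. A \<subseteq> {1..N} \<and> card A = nat k}"
    then have "A \<subseteq> {1..N}" "card A = nat k" by blast+
    moreover from this(1) have "card A \<le> N" using card_mono[of "{1..N}" A] by simp
    ultimately show False using assms by linarith
  qed
  then have "{A. A \<subseteq> {1..N} \<and> card A = nat k} = {}" by blast
  then show ?thesis unfolding esym_def by (simp only: sum.empty if_cancel)
qed

lemma esym_0 [simp]: "esym N 0 = 1"
proof -
  have "{A. A \<subseteq> {1..N} \<and> card A = 0} = {{}}" using finite_subset[of _ "{1..N}"] by auto
  then show ?thesis unfolding esym_def by simp
qed

lemma prod_monom_1: "finite A \<Longrightarrow> (\<Prod>i\<in>A. monom (a i) (Suc 0)) = monom (\<Prod>i\<in>A. a i) (card A)"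
  by (induction A rule: finite_induct) (auto simp: mult_monom)

text \<open>The generating function of the elementary symmetric polynomials: expanding the product
  amounts to choosing the subset of factors that contribute their linear term.\<close>

lemma ev_esym_coeff: "ev a (esym N (int k)) = coeff (\<Prod>i\<in>{1..N}. [:1, a i:]) k"
proof -
  have "(\<Prod>i\<in>{1..N}. [:1, a i:]) = (\<Prod>i\<in>{1..N}. monom (a i) (Suc 0) + 1)"
    by (intro prod.cong refl) (simp add: monom_Suc monom_0 one_pCons)
  also have "\<dots> = (\<Sum>X\<in>Pow {1..N}. \<Prod>i\<in>X. monom (a i) (Suc 0))"
    by (subst prod_add) auto
  also have "\<dots> = (\<Sum>X\<in>Pow {1..N}. monom (\<Prod>i\<in>X. a i) (card X))"
    by (intro sum.cong refl prod_monom_1) (auto intro: finite_subset)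
  also have "coeff \<dots> k = (\<Sum>X\<in>Pow {1..N}. if card X = k then \<Prod>i\<in>X. a i else 0)"
    by (simp add: coeff_sum)
  also have "\<dots> = ev a (esym N (int k))"
    unfolding ev_esym by (intro sum.mono_neutral_cong_right) auto
  finally show ?thesis by simp
qed

text \<open>Roots are split off by the fundamental theorem of algebra. They are nonzero because the
  constant term is 1, so each factor can be scaled to constant term 1; missing factors are filled up
  with \<open>a i = 0\<close>.\<close>

lemma poly_as_prod_linear:
  fixes p :: "complex poly"
  assumes "poly p 0 = 1" "degree p \<le> d"
  shows "\<exists>a. p = (\<Prod>i\<in>{1..d}. [:1, a i:])"
  using assms
proof (induction d arbitrary: p)
  case 0
  then show ?case by (auto elim!: degree_eq_zeroE simp: one_pCons)
next
  case (Suc d)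
  show ?case
  proof (cases "degree p = 0")
    case True
    with Suc.prems have "p = 1" by (auto elim!: degree_eq_zeroE simp: one_pCons)
    then show ?thesis by (intro exI[of _ "\<lambda>_. 0"]) (simp flip: one_pCons)
  next
    case False
    then obtain z where z: "poly p z = 0"
      using fundamental_theorem_of_algebra[of p] by (auto simp: constant_degree)
    with Suc.prems have z0: "z \<noteq> 0" by auto
    from z obtain q where q: "p = [:- z, 1:] * q" by (auto simp: poly_eq_0_iff_dvd elim: dvdE)
    define q' where "q' = Polynomial.smult (- z) q"
    have "[:- z, 1:] = Polynomial.smult (- z) [:1, - inverse z:]" using z0 by simp
    then have pq: "p = [:1, - inverse z:] * q'"
      by (simp only: q q'_def mult_smult_left mult_smult_right)
    have "q' \<noteq> 0" using pq Suc.prems by auto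
    then have "degree p = Suc (degree q')"
      unfolding pq using z0 by (subst degree_mult_eq) auto
    moreover have "poly q' 0 = 1" using Suc.prems pq by simp
    ultimately obtain a where a: "q' = (\<Prod>i\<in>{1..d}. [:1, a i:])"
      using Suc.IH[of q'] Suc.prems by auto
    have "p = (\<Prod>i\<in>{1..Suc d}. [:1, (a(Suc d := - inverse z)) i:])"
      unfolding prod.nat_ivl_Suc' [OF le_SucI, OF le_add1[of 1 d, unfolded add_Suc_right]] pq a
      by (simp add: prod.cl_ivl_Suc mult.commute)
    then show ?thesis by blast
  qed
qed

text \<open>Provides test points with prescribed elementary symmetric values. A small
  \<open>d\<close> makes the last coordinates vanish, so that the point also satisfies the
  specialisation.\<close>

lemma exists_point_with_esym:
  fixes p :: "complex poly"
  assumes "poly p 0 = 1" "degree p \<le> d" "d \<le> N"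
  obtains a where "\<And>i. i > d \<Longrightarrow> a i = 0" "\<And>k. ev a (esym N (int k)) = coeff p k"
proof -
  obtain a where a: "p = (\<Prod>i\<in>{1..d}. [:1, a i:])" using poly_as_prod_linear[OF assms(1,2)] by blast
  define b where "b i = (if i \<le> d then a i else 0)" for i
  have "p = (\<Prod>i\<in>{1..N}. [:1, b i:])"
    unfolding a using assms(3)
    by (intro prod.mono_neutral_cong_left) (auto simp: b_def one_pCons)
  then show ?thesis using that[of b] ev_esym_coeff[of b N] by (simp add: b_def)
qed

section \<open>The specialisation of the last variable to minus the one before it\<close>

definition spec :: "nat \<Rightarrow> mpol \<Rightarrow> mpol" where
  "spec N = subst (xvar(N := - xvar (N - 1)))"

lemma spec_hom [simp]:
  "spec N (p + q) = spec N p + spec N q" "spec N (p * q) = spec N p * spec N q"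
  "spec N 0 = 0" "spec N 1 = 1" "spec N (p - q) = spec N p - spec N q"
  "spec N (- p) = - spec N p" "spec N (p ^ k) = spec N p ^ k"
  "spec N (sum f I) = (\<Sum>i\<in>I. spec N (f i))"
  by (simp_all add: spec_def)

lemma spec_eq_0D:
  assumes "spec N p = 0" "a N = - a (N - 1)"
  shows "ev a p = 0"
proof -
  have "(\<lambda>i. ev a ((xvar(N := - xvar (N - 1))) i)) = a" using assms(2) by auto
  then show ?thesis using arg_cong[OF assms(1), of "ev a"] by (simp add: spec_def)
qed

lemma xvar_nonzero [simp]: "xvar i \<noteq> 0"
proof -
  have "ev (\<lambda>_. 1) (xvar i) \<noteq> ev (\<lambda>_. 1) 0" by simp
  then show ?thesis by metis
qed

text \<open>Points with a zero coordinate N - 1 may be left out: multiplication by that variable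
  makes the comparison trivial there, and the factor cancels afterwards.\<close>

lemma spec_eq_0I:
  assumes "N \<ge> 1" "\<And>a. a N = - a (N - 1) \<Longrightarrow> a (N - 1) \<noteq> 0 \<Longrightarrow> ev a p = 0"
  shows "spec N p = 0"
proof -
  have "ev a (xvar (N - 1) * spec N p) = ev a 0" for a
    using assms by (cases "a (N - 1) = 0") (auto simp: spec_def)
  then have "xvar (N - 1) * spec N p = 0" by (rule ev_inject)
  then show ?thesis by simp
qed

lemma sum_even_odd: 
  fixes f :: "nat \<Rightarrow> 'a::comm_monoid_add"
  shows "(\<Sum>k\<le>2 * n. f k) = (\<Sum>j\<le>n. f (2 * j)) + (\<Sum>s<n. f (2 * s + 1))"
  by (induction n) (simp_all add: ac_simps)

lemma power_diff_inverse:
  fixes x :: "'a::field"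
  assumes "x \<noteq> 0" "j \<le> m"
  shows "x ^ (2 * (m - j)) = x ^ (2 * m) * inverse x ^ (2 * j)"
proof -
  have "2 * m = 2 * (m - j) + 2 * j" using assms by simp
  then have "x ^ (2 * m) = x ^ (2 * (m - j)) * x ^ (2 * j)" by (simp only: power_add)
  then show ?thesis using assms by (simp add: power_inverse)
qed

text \<open>With last coordinates x and -x the generating product contains (1 + x T)(1 - x T), so it
  vanishes at T = 1/x and T = -1/x. Sum and difference of the two values isolate the even and the
  odd part; a power of x clears the denominators.\<close>

lemma spec_esym:
  assumes "n \<ge> 1"
  shows "spec (2 * n) (\<Sum>j\<le>n. esym (2 * n) (2 * int j) * xvar (2 * n - 1) ^ (2 * (n - j))) = 0"
    and "spec (2 * n) (\<Sum>s<n. esym (2 * n) (2 * int s + 1) * xvar (2 * n - 1) ^ (2 * (n - 1 - s))) = 0"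
proof -
  have key: "(\<Sum>j\<le>n. ev a (esym (2 * n) (2 * int j)) * t ^ (2 * j)) = 0 \<and>
     (\<Sum>s<n. ev a (esym (2 * n) (2 * int s + 1)) * t ^ (2 * s)) = 0"
    if a: "a (2 * n) = - a (2 * n - 1)" "a (2 * n - 1) \<noteq> 0" and t: "t = inverse (a (2 * n - 1))" for a t
  proof -
    define c where "c k = ev a (esym (2 * n) (int k))" for k
    let ?P = "\<Prod>i\<in>{1..2 * n}. [:1, a i:]"
    have "degree ?P \<le> (\<Sum>i\<in>{1..2 * n}. degree [:1, a i:])"
      using degree_prod_sum_le[of "{1..2 * n}" "\<lambda>i. [:1, a i:]"] by (simp add: comp_def)
    also have "\<dots> \<le> (\<Sum>i\<in>{1..2 * n}. 1)"
      by (intro sum_mono) simp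
    finally have "degree ?P \<le> (\<Sum>i\<in>{1..2 * n}. 1)" .
    then have deg: "degree ?P \<le> 2 * n" by simp
    have P: "poly ?P u = (\<Sum>k\<le>2 * n. c k * u ^ k)" for u
      unfolding c_def ev_esym_coeff 
      by (subst poly_as_sum_of_monoms'[OF deg, symmetric]) (simp only: poly_sum poly_monom)
    have zero: "poly ?P u = 0" if "i \<in> {1..2 * n}" "1 + u * a i = 0" for i u
      unfolding poly_prod prod_zero_iff[OF finite_atLeastAtMost] using that
      by (intro bexI[of _ i]) simp_all
    have "poly ?P t = 0"
      by (rule zero[of "2 * n"]) (use a assms in \<open>auto simp: t\<close>)
    moreover have "poly ?P (- t) = 0"
      by (rule zero[of "2 * n - 1"]) (use a assms in \<open>auto simp: t\<close>)
    ultimately have "(\<Sum>j\<le>n. c (2 * j) * t ^ (2 * j)) + (\<Sum>s<n. c (2 * s + 1) * t ^ (2 * s + 1)) = 0"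
      "(\<Sum>j\<le>n. c (2 * j) * t ^ (2 * j)) - (\<Sum>s<n. c (2 * s + 1) * t ^ (2 * s + 1)) = 0"
      unfolding P sum_even_odd by (simp_all add: sum_negf)
    then have 0: "(\<Sum>j\<le>n. c (2 * j) * t ^ (2 * j)) = 0" 
      and 1: "(\<Sum>s<n. c (2 * s + 1) * t ^ (2 * s + 1)) = 0" by (simp_all add: add_eq_0_iff2)
    have "(\<Sum>s<n. c (2 * s + 1) * t ^ (2 * s + 1)) = t * (\<Sum>s<n. c (2 * s + 1) * t ^ (2 * s))"
      by (simp add: sum_distrib_left mult_ac)
    with 1 a t have "(\<Sum>s<n. c (2 * s + 1) * t ^ (2 * s)) = 0" by simp
    with 0 show ?thesis by (simp add: c_def add_ac)
  qed
  show "spec (2 * n) (\<Sum>j\<le>n. esym (2 * n) (2 * int j) * xvar (2 * n - 1) ^ (2 * (n - j))) = 0"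
  proof (rule spec_eq_0I)
    fix a :: "nat \<Rightarrow> complex" assume a: "a (2 * n) = - a (2 * n - 1)" "a (2 * n - 1) \<noteq> 0"
    let ?x = "a (2 * n - 1)"
    have "ev a (\<Sum>j\<le>n. esym (2 * n) (2 * int j) * xvar (2 * n - 1) ^ (2 * (n - j))) =
       (\<Sum>j\<le>n. ?x ^ (2 * n) * (ev a (esym (2 * n) (2 * int j)) * inverse ?x ^ (2 * j)))"
      unfolding ev_sum
    proof (intro sum.cong refl)
      fix j assume "j \<in> {..n}"
      then have "j \<le> n" by auto
      from power_diff_inverse[OF a(2) this]
      show "ev a (esym (2 * n) (2 * int j) * xvar (2 * n - 1) ^ (2 * (n - j))) =
          ?x ^ (2 * n) * (ev a (esym (2 * n) (2 * int j)) * inverse ?x ^ (2 * j))"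
        by (simp only: ev_mult ev_power ev_xvar mult_ac)
    qed
    also have "\<dots> = 0" using key[OF a refl] by (simp add: sum_distrib_left[symmetric])
    finally show "ev a (\<Sum>j\<le>n. esym (2 * n) (2 * int j) * xvar (2 * n - 1) ^ (2 * (n - j))) = 0" .
  qed (use assms in simp)
  show "spec (2 * n) (\<Sum>s<n. esym (2 * n) (2 * int s + 1) * xvar (2 * n - 1) ^ (2 * (n - 1 - s))) = 0"
  proof (rule spec_eq_0I)
    fix a :: "nat \<Rightarrow> complex" assume a: "a (2 * n) = - a (2 * n - 1)" "a (2 * n - 1) \<noteq> 0"
    let ?x = "a (2 * n - 1)"
    have "ev a (\<Sum>s<n. esym (2 * n) (2 * int s + 1) * xvar (2 * n - 1) ^ (2 * (n - 1 - s))) =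
       (\<Sum>s<n. ?x ^ (2 * (n - 1)) * (ev a (esym (2 * n) (2 * int s + 1)) * inverse ?x ^ (2 * s)))"
      unfolding ev_sum
    proof (intro sum.cong refl)
      fix s assume "s \<in> {..<n}"
      then have "s \<le> n - 1" by auto
      from power_diff_inverse[OF a(2) this]
      show "ev a (esym (2 * n) (2 * int s + 1) * xvar (2 * n - 1) ^ (2 * (n - 1 - s))) =
          ?x ^ (2 * (n - 1)) * (ev a (esym (2 * n) (2 * int s + 1)) * inverse ?x ^ (2 * s))"
        by (simp only: ev_mult ev_power ev_xvar mult_ac)
    qed
    also have "\<dots> = 0" using key[OF a refl] by (simp add: sum_distrib_left[symmetric])
    finally show "ev a (\<Sum>s<n. esym (2 * n) (2 * int s + 1) * xvar (2 * n - 1) ^ (2 * (n - 1 - s))) = 0" .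
  qed (use assms in simp)
qed


subsection \<open>Determinants\<close>

lemma adj_mat_sums:
  fixes A :: "'a::comm_ring_1 mat"
  assumes "A \<in> carrier_mat n n" "i < n" "j < n"
  shows "(\<Sum>k<n. adj_mat A $$ (i, k) * A $$ (k, j)) = (if i = j then det A else 0)"
    and "(\<Sum>k<n. A $$ (i, k) * adj_mat A $$ (k, j)) = (if i = j then det A else 0)"
proof -
  note adj = adj_mat[OF assms(1)]
  have "(\<Sum>k<n. adj_mat A $$ (i, k) * A $$ (k, j)) = (adj_mat A * A) $$ (i, j)"
    using assms adj(1) by (simp add: scalar_prod_def lessThan_atLeast0)
  also have "\<dots> = (if i = j then det A else 0)"
    unfolding adj(3) using assms by simp
  finally show "(\<Sum>k<n. adj_mat A $$ (i, k) * A $$ (k, j)) = (if i = j then det A else 0)" .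
  have "(\<Sum>k<n. A $$ (i, k) * adj_mat A $$ (k, j)) = (A * adj_mat A) $$ (i, j)"
    using assms adj(1) by (simp add: scalar_prod_def lessThan_atLeast0)
  also have "\<dots> = (if i = j then det A else 0)"
    unfolding adj(2) using assms by simp
  finally show "(\<Sum>k<n. A $$ (i, k) * adj_mat A $$ (k, j)) = (if i = j then det A else 0)" .
qed

text \<open>The identity adj(A) (A u) = det(A) u in coordinates: a vector in the kernel with an
  entry 1 forces the determinant to vanish.\<close>

lemma det_mult_right:
  fixes A :: "'a::comm_ring_1 mat"
  assumes "A \<in> carrier_mat n n" "t < n"
  shows "det A * u t = (\<Sum>r<n. adj_mat A $$ (t, r) * (\<Sum>s<n. A $$ (r, s) * u s))"
proof -
  have "(\<Sum>r<n. adj_mat A $$ (t, r) * (\<Sum>s<n. A $$ (r, s) * u s)) =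
      (\<Sum>s<n. (\<Sum>r<n. adj_mat A $$ (t, r) * A $$ (r, s)) * u s)"
    unfolding sum_distrib_left sum_distrib_right mult.assoc by (rule sum.swap)
  also have "\<dots> = det A * u t"
    using assms by (simp add: adj_mat_sums if_distrib if_distribR cong: if_cong)
  finally show ?thesis ..
qed

text \<open>The transposed identity (c A) adj(A) = det(A) c: a relation between the rows is trivial
  if the determinant is not zero.\<close>

lemma det_mult_left:
  fixes A :: "'a::comm_ring_1 mat"
  assumes "A \<in> carrier_mat n n" "t < n"
  shows "det A * c t = (\<Sum>s<n. (\<Sum>r<n. c r * A $$ (r, s)) * adj_mat A $$ (s, t))"
proof -
  have "(\<Sum>s<n. (\<Sum>r<n. c r * A $$ (r, s)) * adj_mat A $$ (s, t)) =
      (\<Sum>r<n. c r * (\<Sum>s<n. A $$ (r, s) * adj_mat A $$ (s, t)))"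
    unfolding sum_distrib_left sum_distrib_right mult.assoc by (rule sum.swap)
  also have "\<dots> = det A * c t"
    using assms by (simp add: adj_mat_sums if_distrib if_distribR mult.commute cong: if_cong)
  finally show ?thesis ..
qed

text \<open>Replacing row \<open>r\<close> does not affect the cofactors along it, so expansion
  along that row gives an entry of f adj(A), and f adj(A) A = det(A) f.\<close>

lemma cramer_rows:
  fixes A :: "'a::comm_ring_1 mat"
  assumes A: "A \<in> carrier_mat n n" and t: "t < n"
  shows "det A * f t =
    (\<Sum>r<n. det (mat n n (\<lambda>(i, j). if i = r then f j else A $$ (i, j))) * A $$ (r, t))"
proof -
  have row: "det (mat n n (\<lambda>(i, j). if i = r then f j else A $$ (i, j))) =
      (\<Sum>s<n. f s * adj_mat A $$ (s, r))" (is "det ?B = _") if r: "r < n" for r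
  proof -
    have "mat_delete ?B r s = mat_delete A r s" if "s < n" for s
      unfolding mat_delete_def using A r that by (intro cong_mat) auto
    then have "cofactor ?B r s = adj_mat A $$ (s, r)" if "s < n" for s
      using A r that by (simp add: adj_mat_def cofactor_def)
    moreover have "det ?B = (\<Sum>s<n. ?B $$ (r, s) * cofactor ?B r s)"
      using r by (intro laplace_expansion_row) auto
    ultimately show ?thesis using r by simp
  qed
  have "(\<Sum>r<n. det (mat n n (\<lambda>(i, j). if i = r then f j else A $$ (i, j))) * A $$ (r, t)) =
      (\<Sum>r<n. (\<Sum>s<n. f s * adj_mat A $$ (s, r)) * A $$ (r, t))"
    by (simp add: row)
  also have "\<dots> = (\<Sum>s<n. f s * (\<Sum>r<n. adj_mat A $$ (s, r) * A $$ (r, t)))"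
    unfolding sum_distrib_left sum_distrib_right mult.assoc by (rule sum.swap)
  also have "\<dots> = f t * det A"
    using assms by (simp add: adj_mat_sums if_distrib if_distribR cong: if_cong)
  finally show ?thesis by (simp only: mult.commute)
qed

lemma det_sym_ring:
  assumes "\<And>i j. i < n \<Longrightarrow> j < n \<Longrightarrow> f i j \<in> sym_ring N"
  shows "det (mat n n (\<lambda>(i, j). f i j)) \<in> sym_ring N"
proof -
  have "signof p * (\<Prod>i=0..<n. mat n n (\<lambda>(i, j). f i j) $$ (i, p i)) \<in> sym_ring N"
    if p: "p permutes {0..<n}" for p
  proof (intro sym_ring_mult sym_ring_prod)
    show "(signof p :: mpol) \<in> sym_ring N" unfolding sign_def by (auto)
    fix i assume "i \<in> {0..<n}"
    with permutes_in_image[OF p, of i] assms show "mat n n (\<lambda>(i, j). f i j) $$ (i, p i) \<in> sym_ring N"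
      by simp
  qed
  then show ?thesis by (subst det_def'[OF mat_carrier]) (auto intro!: sym_ring_sum)
qed

text \<open>The antidiagonal matrix is its own inverse, so its determinant has square 1.\<close>

lemma det_antidiagonal_nonzero:
  "det (mat (Suc m) (Suc m) (\<lambda>(i, j). if i + j = m then 1 else (0::complex))) \<noteq> 0" (is "det ?J \<noteq> 0")
proof -
  have "?J * ?J = 1\<^sub>m (Suc m)"
  proof (rule eq_matI)
    fix i j assume "i < dim_row (1\<^sub>m (Suc m))" "j < dim_col (1\<^sub>m (Suc m))"
    then have ij: "i < Suc m" "j < Suc m" by auto
    have "(?J * ?J) $$ (i, j) = (\<Sum>k = 0..<Suc m. (if i + k = m then 1 else 0) * (if k + j = m then 1 else 0))"
      using ij by (simp add: scalar_prod_def del: sum.op_ivl_Suc)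
    also have "\<dots> = (\<Sum>k = 0..<Suc m. if k = m - i then (if i = j then 1 else 0) else 0)"
      using ij by (intro sum.cong refl) auto
    also have "\<dots> = 1\<^sub>m (Suc m) $$ (i, j)" using ij by (simp add: less_Suc_eq_le del: sum.op_ivl_Suc)
    finally show "(?J * ?J) $$ (i, j) = 1\<^sub>m (Suc m) $$ (i, j)" .
  qed simp_all
  then have "det ?J * det ?J = 1"
    using det_mult[of ?J "Suc m" ?J] by simp
  then show ?thesis by auto
qed

lemma ev_comm_ring_hom: "comm_ring_hom (ev a)"
  by unfold_locales simp_all

subsection \<open>The coefficient vectors\<close>

definition esym_even :: "nat \<Rightarrow> nat \<Rightarrow> mpol" where "esym_even n j = esym (2 * n) (2 * int j)"

text \<open>Shifted indices: \<open>Pvec n r s\<close> is \<open>P\<^sub>r\<^sub>+\<^sub>1\<^sub>,\<^sub>s\<^sub>+\<^sub>1\<close> and belongs to the exponent \<open>2 s\<close> of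
  \<open>v\<^sub>r\<^sub>+\<^sub>1\<close>.\<close>

definition Pvec :: "nat \<Rightarrow> nat \<Rightarrow> nat \<Rightarrow> mpol" where "Pvec n r s = Pcoef n (Suc r) (int s + 1)"

lemma esym_even_0 [simp]: "esym_even n 0 = 1" by (simp add: esym_even_def)

lemma esym_even_large [simp]: "j > n \<Longrightarrow> esym_even n j = 0" by (simp add: esym_even_def)

lemma esym_even_sym [simp, intro]: "esym_even n j \<in> sym_ring (2 * n)" by (simp add: esym_even_def)

lemma Pvec_0: "Pvec n 0 s = esym (2 * n) (2 * int s + 1)"
  by (simp add: Pvec_def algebra_simps)

lemma Pvec_Suc: "Pvec n (Suc r) s = Pvec n r (Suc s) - esym_even n (Suc s) * Pvec n r 0"
  by (simp add: Pvec_def esym_even_def algebra_simps)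

lemma Pvec_large [simp]: "s \<ge> n \<Longrightarrow> Pvec n r s = 0"
  by (induction r arbitrary: s) (simp_all add: Pvec_0 Pvec_Suc)

lemma Pvec_sym [simp, intro]: "Pvec n r s \<in> sym_ring (2 * n)"
  by (induction r arbitrary: s) (auto simp: Pvec_0 Pvec_Suc)

text \<open>At a point where \<open>\<Prod>\<^sub>i (1 + a\<^sub>i T) = 1 + T\<^sup>2\<^sup>m\<^sup>+\<^sup>1\<close> the recursion for \<open>P\<^sub>r\<^sub>,\<^sub>s\<close> is a pure shift.\<close>

lemma ev_Pvec_antidiagonal:
  assumes "m < n"
  obtains a where "\<And>i. i > 2 * m + 1 \<Longrightarrow> a i = 0"
    "\<And>r s. ev a (Pvec n r s) = (if r + s = m then 1 else 0)"
proof -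
  let ?p = "1 + monom 1 (2 * m + 1) :: complex poly"
  have "degree ?p \<le> 2 * m + 1"
    by (intro degree_add_le) (auto simp: degree_monom_le)
  then obtain a where a: "\<And>i. i > 2 * m + 1 \<Longrightarrow> a i = 0"
      "\<And>k. ev a (esym (2 * n) (int k)) = coeff ?p k"
    using exists_point_with_esym[of ?p "2 * m + 1" "2 * n"] assms
    by (auto simp: poly_monom)
  have esym_even: "ev a (esym_even n (Suc j)) = 0" for j
    using a(2)[of "2 * Suc j"] by (simp add: esym_even_def) presburger
  have Pvec0: "ev a (Pvec n 0 s) = (if s = m then 1 else 0)" for s
    using a(2)[of "2 * s + 1"] by (simp add: Pvec_0 add_ac)
  have "ev a (Pvec n r s) = (if r + s = m then 1 else 0)" for r s
    by (induction r arbitrary: s) (simp_all add: Pvec0 Pvec_Suc esym_even)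
  with a(1) show ?thesis using that by blast
qed

text \<open>For m = n - 1 this shows that the full determinant is not zero. For m = n - 2 the last
  two coordinates are 0, so the leading minor of size n - 1 survives the specialisation.\<close>

lemma det_Pvec_ev_nonzero:
  assumes "m < n"
  obtains a where "\<And>i. i > 2 * m + 1 \<Longrightarrow> a i = 0"
    "ev a (det (mat (Suc m) (Suc m) (\<lambda>(r, s). Pvec n r s))) \<noteq> 0"
proof -
  obtain a where a: "\<And>i. i > 2 * m + 1 \<Longrightarrow> a i = 0"
    "\<And>r s. ev a (Pvec n r s) = (if r + s = m then 1 else 0)"
    using ev_Pvec_antidiagonal[OF assms] by blast
  interpret comm_ring_hom "ev a" by (rule ev_comm_ring_hom)
  have "map_mat (ev a) (mat (Suc m) (Suc m) (\<lambda>(r, s). Pvec n r s)) =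
      mat (Suc m) (Suc m) (\<lambda>(i, j). if i + j = m then 1 else 0)"
    by (intro eq_matI) (auto simp: a(2))
  then have "ev a (det (mat (Suc m) (Suc m) (\<lambda>(r, s). Pvec n r s))) \<noteq> 0"
    using det_antidiagonal_nonzero[of m] by (simp flip: hom_det)
  with a(1) show ?thesis using that by blast
qed

text \<open>With \<open>x = x\<^sub>2\<^sub>n\<^sub>-\<^sub>1\<close>, this is \<open>x\<^sup>2\<^sup>(\<^sup>n\<^sup>-\<^sup>1\<^sup>)\<close> times the value of \<open>\<Sum>\<^sub>s f\<^sub>s X\<^sup>2\<^sup>s\<close> at \<open>X = \<plusminus> x\<^sup>-\<^sup>1\<close>;
  a row of an element of \<open>U2 n\<close> splits into an even and an odd part of this kind.\<close>

definition tail_eval :: "nat \<Rightarrow> (nat \<Rightarrow> mpol) \<Rightarrow> mpol" where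
  "tail_eval n f = (\<Sum>s<n. f s * xvar (2 * n - 1) ^ (2 * (n - 1 - s)))"

text \<open>The module V. Only the entries below \<open>n\<close> are constrained, so functions on
  all naturals serve as vectors of length \<open>n\<close>.\<close>

definition in_V :: "nat \<Rightarrow> (nat \<Rightarrow> mpol) \<Rightarrow> bool" where
  "in_V n f \<longleftrightarrow> (\<forall>s<n. f s \<in> sym_ring (2 * n)) \<and> spec (2 * n) (tail_eval n f) = 0"

lemma tail_eval_cong: "(\<And>s. s < n \<Longrightarrow> f s = g s) \<Longrightarrow> tail_eval n f = tail_eval n g"
  by (simp add: tail_eval_def)

lemma tail_eval_add: "tail_eval n (\<lambda>s. f s + g s) = tail_eval n f + tail_eval n g"
  by (simp add: tail_eval_def distrib_right sum.distrib)

lemma tail_eval_sum: "tail_eval n (\<lambda>s. \<Sum>i\<in>I. f i s * c i) = (\<Sum>i\<in>I. tail_eval n (f i) * c i)"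
  unfolding tail_eval_def sum_distrib_right by (subst sum.swap) (simp add: mult_ac)

lemma in_V_add: "in_V n f \<Longrightarrow> in_V n g \<Longrightarrow> in_V n (\<lambda>s. f s + g s)"
  by (auto simp: in_V_def tail_eval_add)

lemma in_V_sum:
  assumes "\<And>i. i \<in> I \<Longrightarrow> in_V n (f i)" "\<And>i. i \<in> I \<Longrightarrow> c i \<in> sym_ring (2 * n)"
  shows "in_V n (\<lambda>s. \<Sum>i\<in>I. c i * f i s)"
proof -
  have "in_V n (\<lambda>s. \<Sum>i\<in>I. f i s * c i)"
    using assms by (auto simp: in_V_def tail_eval_sum intro!: sym_ring_sum)
  then show ?thesis by (simp add: mult.commute)
qed

lemma in_V_mult:
  assumes "in_V n f" "c \<in> sym_ring (2 * n)"
  shows "in_V n (\<lambda>s. c * f s)"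
  using in_V_sum[of "{()}" n "\<lambda>_. f" "\<lambda>_. c"] assms by simp

text \<open>The shift in the recursion multiplies the value by x^2. The entry shifted out is the
  term j = 0 of the subtracted sum, because \<open>esym_even n 0\<close> is 1.\<close>

lemma tail_eval_Pvec_Suc:
  assumes "n \<ge> 1"
  shows "tail_eval n (Pvec n (Suc r)) = xvar (2 * n - 1) ^ 2 * tail_eval n (Pvec n r)
    - Pvec n r 0 * (\<Sum>j\<le>n. esym_even n j * xvar (2 * n - 1) ^ (2 * (n - j)))"
proof -
  let ?x = "xvar (2 * n - 1)"
  define g where "g s = Pvec n r s * ?x ^ (2 * (n - s))" for s
  have "?x ^ 2 * tail_eval n (Pvec n r) = (\<Sum>s<n. g s)"
    unfolding tail_eval_def sum_distrib_left g_def
  proof (intro sum.cong refl)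
    fix s assume "s \<in> {..<n}"
    then have "2 * (n - s) = 2 + 2 * (n - 1 - s)" by auto
    then show "?x\<^sup>2 * (Pvec n r s * ?x ^ (2 * (n - 1 - s))) = Pvec n r s * ?x ^ (2 * (n - s))"
      by (simp only: power_add) (simp only: mult_ac)
  qed
  \<comment> \<open>\<open>g n\<close> is 0, so the range can be extended by one before
    shifting.\<close>
  also have "\<dots> = (\<Sum>s<Suc n. g s)" by (simp add: g_def)
  also have "\<dots> = g 0 + (\<Sum>s<n. g (Suc s))" by (rule sum.lessThan_Suc_shift)
  finally have 1: "?x ^ 2 * tail_eval n (Pvec n r) = g 0 + (\<Sum>s<n. g (Suc s))" .
  have 2: "Pvec n r 0 * (\<Sum>j\<le>n. esym_even n j * ?x ^ (2 * (n - j))) =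
      g 0 + (\<Sum>s<n. esym_even n (Suc s) * Pvec n r 0 * ?x ^ (2 * (n - Suc s)))"
    unfolding lessThan_Suc_atMost[symmetric] sum.lessThan_Suc_shift
    by (simp add: g_def distrib_left sum_distrib_left mult_ac)
  show ?thesis
    unfolding 1 2 by (simp add: tail_eval_def Pvec_Suc g_def left_diff_distrib sum_subtractf)
qed

text \<open>The recursion starts with the odd part of the generating function and subtracts
  multiples of its even part; both vanish under the specialisation.\<close>

lemma Pvec_in_V:
  assumes "n \<ge> 1"
  shows "in_V n (Pvec n r)"
proof -
  have "spec (2 * n) (tail_eval n (Pvec n r)) = 0"
  proof (induction r)
    case 0
    show ?case using spec_esym(2)[OF assms] by (simp add: tail_eval_def Pvec_0)
  next
    case (Suc r)
    show ?case unfolding tail_eval_Pvec_Suc[OF assms]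
      using Suc spec_esym(1)[OF assms] by (simp only: spec_hom esym_even_def) simp
  qed
  then show ?thesis by (simp add: in_V_def)
qed

lemma det_in_V:
  assumes n: "n \<ge> 1" and f: "\<And>r. r < n \<Longrightarrow> in_V n (f r)"
  obtains q where "q \<in> sym_ring (2 * n)" "det (mat n n (\<lambda>(r, s). f r s)) = sum_prod (2 * n) * q"
proof -
  let ?A = "mat n n (\<lambda>(r, s). f r s)"
  let ?u = "\<lambda>s. xvar (2 * n - 1) ^ (2 * (n - 1 - s))"
  \<comment> \<open>After specialisation the vector \<open>?u\<close> lies in the kernel of the
    matrix, and its last entry is 1.\<close>
  have "det ?A * ?u (n - 1) = (\<Sum>r<n. adj_mat ?A $$ (n - 1, r) * (\<Sum>s<n. ?A $$ (r, s) * ?u s))"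
    using n by (intro det_mult_right) auto
  also have "\<dots> = (\<Sum>r<n. adj_mat ?A $$ (n - 1, r) * tail_eval n (f r))"
    by (intro sum.cong refl) (simp add: tail_eval_def)
  also have "spec (2 * n) \<dots> = 0" using f by (simp add: in_V_def)
  finally have "spec (2 * n) (det ?A) = 0" by simp
  moreover have "det ?A \<in> sym_ring (2 * n)"
    by (rule det_sym_ring) (use f in \<open>auto simp: in_V_def\<close>)
  ultimately show ?thesis
    using sum_prod_dvd[of "2 * n" "det ?A"] n that spec_eq_0D by auto
qed

subsection \<open>The determinant of the matrix of all coefficients\<close>

text \<open>Homogeneity is expressed by doubling all coordinates; the single factor 2 already
  determines the degree.\<close>

lemma ev_double_esym: "ev (\<lambda>i. 2 * a i) (esym N (int k)) = 2 ^ k * ev a (esym N (int k))"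
  unfolding ev_esym sum_distrib_left by (intro sum.cong refl) (auto simp: prod.distrib)

lemma ev_double_Pvec: "ev (\<lambda>i. 2 * a i) (Pvec n r s) = 2 ^ (2 * r + 2 * s + 1) * ev a (Pvec n r s)"
proof (induction r arbitrary: s)
  case 0
  show ?case using ev_double_esym[of a "2 * n" "2 * s + 1"] by (simp add: Pvec_0 add_ac)
next
  case (Suc r)
  have "ev (\<lambda>i. 2 * a i) (esym_even n (Suc s)) = 2 ^ (2 * Suc s) * ev a (esym_even n (Suc s))"
    using ev_double_esym[of a "2 * n" "2 * Suc s"] by (simp add: esym_even_def)
  then show ?case
    by (simp only: Pvec_Suc ev_diff ev_mult Suc.IH) (simp add: power_add algebra_simps)
qed

text \<open>For every permutation the Leibniz term has the degree given by the sum of 2 i + 2 p(i) +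
  1, which is the sum of 4 i + 1. This is also the number of factors of
  \<open>sum_prod (2 * n)\<close>.\<close>

lemma ev_double_det_Pvec:
  "ev (\<lambda>i. 2 * a i) (det (mat n n (\<lambda>(r, s). Pvec n r s))) =
    2 ^ ((2 * n) choose 2) * ev a (det (mat n n (\<lambda>(r, s). Pvec n r s)))"
proof -
  have count: "(\<Sum>i=0..<n. 2 * i + 2 * p i + 1) = (2 * n) choose 2" if p: "p permutes {0..<n}" for p
  proof -
    have "(\<Sum>i=0..<n. p i) = (\<Sum>i=0..<n. i)" using sum.permute[OF p, of "\<lambda>i. i"] by (simp add: comp_def)
    then have "(\<Sum>i=0..<n. 2 * i + 2 * p i + 1) = (\<Sum>i=0..<n. 4 * i + 1)"
      by (simp only: sum.distrib sum_distrib_left[symmetric])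
    also have "\<dots> = (2 * n) choose 2"
      by (induction n) (simp_all add: choose_two numeral_2_eq_2)
    finally show ?thesis .
  qed
  have "ev (\<lambda>i. 2 * a i) (signof p * (\<Prod>i=0..<n. mat n n (\<lambda>(r, s). Pvec n r s) $$ (i, p i))) =
     2 ^ ((2 * n) choose 2) * ev a (signof p * (\<Prod>i=0..<n. mat n n (\<lambda>(r, s). Pvec n r s) $$ (i, p i)))"
    if p: "p permutes {0..<n}" for p
  proof -
    have s: "ev (\<lambda>i. 2 * a i) (signof p) = ev a (signof p)" by (simp add: sign_def)
    have "(\<Prod>i=0..<n. ev (\<lambda>i. 2 * a i) (mat n n (\<lambda>(r, s). Pvec n r s) $$ (i, p i))) =
        (\<Prod>i=0..<n. 2 ^ (2 * i + 2 * p i + 1) * ev a (mat n n (\<lambda>(r, s). Pvec n r s) $$ (i, p i)))"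
      using permutes_in_image[OF p] by (intro prod.cong refl) (simp add: ev_double_Pvec)
    also have "\<dots> = 2 ^ ((2 * n) choose 2) * (\<Prod>i=0..<n. ev a (mat n n (\<lambda>(r, s). Pvec n r s) $$ (i, p i)))"
      unfolding prod.distrib power_sum[symmetric] count[OF p] ..
    finally show ?thesis by (simp only: ev_mult ev_prod s mult.left_commute)
  qed
  then show ?thesis
    by (simp add: det_def'[OF mat_carrier] sum_distrib_left del: ev_mult ev_prod)
qed

text \<open>Doubling multiplies a monomial of degree d by 2^d, so only d = 0 can occur in the
  support.\<close>

lemma const_of_ev_double:
  assumes "\<And>a. ev (\<lambda>i. 2 * a i) q = ev a q"
  obtains c where "q = const c"
proof -
  have "m = 0" if m: "m \<in> Poly_Mapping.keys q" for m
  proof -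
    have "(\<Sum>m\<in>Poly_Mapping.keys q. (Poly_Mapping.lookup q m * (mono_val (\<lambda>_. 2) m - 1)) * mono_val a m) = 0" for a
      using assms[of a]
      by (simp add: ev_superset[OF finite_keys order_refl] mono_val_mult algebra_simps sum_subtractf)
    from mono_val_independent[OF finite_keys this m] m have "mono_val (\<lambda>_. 2) m = 1"
      by (auto simp: in_keys_iff)
    then have "(2::complex) ^ (\<Sum>i\<in>Poly_Mapping.keys m. Poly_Mapping.lookup m i) = 1"
      by (simp add: mono_val_def power_sum)
    then have "norm ((2::complex) ^ (\<Sum>i\<in>Poly_Mapping.keys m. Poly_Mapping.lookup m i)) = 1" by simp
    then have "(2::real) ^ (\<Sum>i\<in>Poly_Mapping.keys m. Poly_Mapping.lookup m i) = 1"
      by (simp only: norm_power) simp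
    then have "(\<Sum>i\<in>Poly_Mapping.keys m. Poly_Mapping.lookup m i) = 0"
      using one_less_power[of "2::real" "\<Sum>i\<in>Poly_Mapping.keys m. Poly_Mapping.lookup m i"]
      by (cases "(\<Sum>i\<in>Poly_Mapping.keys m. Poly_Mapping.lookup m i) = 0") (simp_all only: neq0_conv, simp)
    then show "m = 0" by (intro poly_mapping_eqI) (auto simp: in_keys_iff)
  qed
  then have "q = const (Poly_Mapping.lookup q 0)"
    by (intro poly_mapping_eqI) (auto simp: const_def lookup_single when_def in_keys_iff)
  then show ?thesis by (rule that)
qed

text \<open>The quotient by \<open>sum_prod\<close> is homogeneous of degree 0, hence constant; the
  antidiagonal point shows that the constant is not zero.\<close>

lemma det_Pvec:
  assumes "n \<ge> 1"
  obtains c where "c \<noteq> 0" "det (mat n n (\<lambda>(r, s). Pvec n r s)) = sum_prod (2 * n) * const c"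
proof -
  let ?d = "det (mat n n (\<lambda>(r, s). Pvec n r s))"
  obtain q where q: "?d = sum_prod (2 * n) * q"
    using det_in_V[OF assms, of "Pvec n"] Pvec_in_V[OF assms] by blast
  define r where "r = subst (\<lambda>i. const 2 * xvar i) q"
  have r: "ev a r = ev (\<lambda>i. 2 * a i) q" for a by (simp add: r_def)
  have D: "ev (\<lambda>i. 2 * a i) (sum_prod (2 * n)) = 2 ^ ((2 * n) choose 2) * ev a (sum_prod (2 * n))" for a
    by (simp add: ev_sum_prod sum_distrib_left[symmetric] prod.distrib card_pairs)
  have "ev a (sum_prod (2 * n) * r) = ev a (sum_prod (2 * n) * q)" for a
    using ev_double_det_Pvec[of a n] unfolding q by (simp add: D r)
  then have "sum_prod (2 * n) * r = sum_prod (2 * n) * q" by (rule ev_inject)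
  then have "r = q" by simp
  with r obtain c where c: "q = const c" using const_of_ev_double[of q] by metis
  obtain a where "ev a ?d \<noteq> 0"
    using det_Pvec_ev_nonzero[of "n - 1" n] assms by auto
  then have "c \<noteq> 0" by (auto simp: q c)
  with q c show ?thesis using that by blast
qed

section \<open>The vectors P as a basis of V\<close>

text \<open>The numerators in Cramer's rule are determinants of vectors in V, hence multiples of
  \<open>sum_prod\<close>, which is the denominator up to a nonzero constant.\<close>

lemma Pvec_spans_V:
  assumes n: "n \<ge> 1" and f: "in_V n f"
  obtains c where "\<And>r. r < n \<Longrightarrow> c r \<in> sym_ring (2 * n)"
    "\<And>s. s < n \<Longrightarrow> f s = (\<Sum>r<n. c r * Pvec n r s)"
proof -
  let ?A = "mat n n (\<lambda>(r, s). Pvec n r s)"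
  let ?D = "sum_prod (2 * n)"
  obtain c where c: "c \<noteq> 0" "det ?A = ?D * const c" using det_Pvec[OF n] by blast
  have "\<exists>q. q \<in> sym_ring (2 * n) \<and>
      det (mat n n (\<lambda>(i, j). if i = r then f j else ?A $$ (i, j))) = ?D * q" if r: "r < n" for r
  proof -
    have "mat n n (\<lambda>(i, j). if i = r then f j else ?A $$ (i, j)) =
        mat n n (\<lambda>(i, j). (if i = r then f else Pvec n i) j)" by (intro eq_matI) auto
    moreover have "in_V n (if i = r then f else Pvec n i)" for i
      using f Pvec_in_V[OF n] by simp
    then obtain q where "q \<in> sym_ring (2 * n)"
        "det (mat n n (\<lambda>(i, j). (if i = r then f else Pvec n i) j)) = ?D * q"
      by (rule det_in_V[OF n])
    ultimately show ?thesis by auto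
  qed
  then have "\<forall>r\<in>{..<n}. \<exists>q. q \<in> sym_ring (2 * n) \<and>
      det (mat n n (\<lambda>(i, j). if i = r then f j else ?A $$ (i, j))) = ?D * q" by blast
  from bchoice[OF this] obtain q where "\<forall>r\<in>{..<n}. q r \<in> sym_ring (2 * n) \<and>
      det (mat n n (\<lambda>(i, j). if i = r then f j else ?A $$ (i, j))) = ?D * q r" ..
  then have q: "q r \<in> sym_ring (2 * n)"
      "det (mat n n (\<lambda>(i, j). if i = r then f j else ?A $$ (i, j))) = ?D * q r" if "r < n" for r
    using that by blast+
  have "f s = (\<Sum>r<n. const (inverse c) * q r * Pvec n r s)" if s: "s < n" for s
  proof -
    have "?D * (const c * f s) = ?D * (\<Sum>r<n. q r * Pvec n r s)"
      using cramer_rows[of ?A n s f] s by (simp add: c q sum_distrib_left mult_ac)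
    then have "const c * f s = (\<Sum>r<n. q r * Pvec n r s)" by simp
    then have "const (inverse c) * (const c * f s) = const (inverse c) * (\<Sum>r<n. q r * Pvec n r s)" by simp
    moreover have "const (inverse c) * const c = 1"
      by (rule ev_inject) (use c in simp)
    ultimately show ?thesis by (simp add: mult.assoc[symmetric] sum_distrib_left)
  qed
  then show ?thesis using that[of "\<lambda>r. const (inverse c) * q r"] q(1) by blast
qed

lemma Pvec_independent:
  assumes n: "n \<ge> 1" and 0: "\<And>s. s < n \<Longrightarrow> (\<Sum>r<n. c r * Pvec n r s) = 0" and r: "r < n"
  shows "c r = 0"
proof -
  let ?A = "mat n n (\<lambda>(r, s). Pvec n r s)"
  obtain d where d: "d \<noteq> 0" "det ?A = sum_prod (2 * n) * const d" using det_Pvec[OF n] by blast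
  then have "const d \<noteq> 0" by (metis ev_const ev_0)
  moreover have "det ?A * c r = 0"
    using det_mult_left[of ?A n r c] r 0 by simp
  ultimately show ?thesis using d by simp
qed

text \<open>The leading minor of size n - 1 is not killed by the specialisation, so a specialised
  relation between the first n - 1 vectors is still trivial.\<close>

lemma spec_Pvec_independent:
  assumes 0: "\<And>s. s < n - 1 \<Longrightarrow> spec (2 * n) (\<Sum>r<n - 1. c r * Pvec n r s) = 0" and r: "r < n - 1"
  shows "spec (2 * n) (c r) = 0"
proof -
  obtain m where m: "n = Suc (Suc m)" using r by (metis less_nat_zero_code old.nat.exhaust diff_Suc_1 diff_0_eq_0)
  let ?A = "mat (Suc m) (Suc m) (\<lambda>(r, s). Pvec n r s)"
  obtain a where a: "\<And>i. i > 2 * m + 1 \<Longrightarrow> a i = 0" "ev a (det ?A) \<noteq> 0"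
    using det_Pvec_ev_nonzero[of m n] m by auto
  have "spec (2 * n) (det ?A) \<noteq> 0"
    using spec_eq_0D[of "2 * n" "det ?A" a] a m by auto
  moreover have "spec (2 * n) (det ?A * c r) = 0"
    using det_mult_left[of ?A "Suc m" r c] r 0 m by (simp del: sum.lessThan_Suc)
  ultimately show ?thesis by simp
qed


subsection \<open>The symmetric blocks of the elements \<open>\<xi>\<^sub>k\<close>\<close>

text \<open>The matrix G with its index shifted by one: \<open>xi n (Suc k)\<close> turns out to be
  X2 - X1 times the polynomial with these coefficients at the even exponents.\<close>

definition xi_mat :: "nat \<Rightarrow> nat \<Rightarrow> nat \<Rightarrow> nat \<Rightarrow> mpol" where
  "xi_mat n k p q = - (\<Sum>i\<le>p. esym_even n (p - i) * Pvec n (k + i) q)"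

lemma xi_mat_0_left: "xi_mat n k 0 q = - Pvec n k q"
  by (simp add: xi_mat_def)

lemma xi_mat_Suc_left: "xi_mat n k (Suc p) q = xi_mat n (Suc k) p q - esym_even n (Suc p) * Pvec n k q"
  unfolding xi_mat_def sum.atMost_Suc_shift by (simp add: algebra_simps)

lemma xi_mat_Suc_right: "xi_mat n k p (Suc q) = xi_mat n (Suc k) p q + esym_even n (Suc q) * xi_mat n k p 0"
proof -
  have "Pvec n r (Suc q) = Pvec n (Suc r) q + esym_even n (Suc q) * Pvec n r 0" for r
    by (simp add: Pvec_Suc)
  then show ?thesis
    by (simp add: xi_mat_def distrib_left sum.distrib sum_distrib_left mult_ac)
qed

text \<open>The row and the column recursion have the same shape: both raise \<open>k\<close> and
  correct by \<open>esym_even\<close> times an entry of the first row or column. Once these two are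
  known to agree, induction gives the rest.\<close>

lemma xi_mat_commute: "xi_mat n k p q = xi_mat n k q p"
proof -
  have base: "xi_mat n k 0 q = xi_mat n k q 0" for k q
    by (induction q arbitrary: k) (simp_all add: xi_mat_Suc_left xi_mat_Suc_right xi_mat_0_left)
  show ?thesis
    by (induction p arbitrary: k q)
      (simp_all add: base, simp add: xi_mat_Suc_left xi_mat_Suc_right base[symmetric] xi_mat_0_left)
qed

text \<open>The vanishing in \<open>p\<close> is not visible in the formula; symmetry derives it
  from the vanishing in \<open>q\<close>.\<close>

lemma xi_mat_large [simp]: "q \<ge> n \<Longrightarrow> xi_mat n k p q = 0" "p \<ge> n \<Longrightarrow> xi_mat n k p q = 0"
proof -
  show right: "xi_mat n k p q = 0" if "q \<ge> n" for p q using that by (simp add: xi_mat_def)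
  show "p \<ge> n \<Longrightarrow> xi_mat n k p q = 0" by (subst xi_mat_commute) (rule right)
qed

lemma xi_mat_sym [simp, intro]: "xi_mat n k p q \<in> sym_ring (2 * n)"
  unfolding xi_mat_def by (intro sym_ring_minus sym_ring_sum sym_ring_mult) auto

lemma xi_mat_in_V:
  assumes "n \<ge> 1"
  shows "in_V n (xi_mat n k p)"
proof -
  have "in_V n (\<lambda>s. \<Sum>i\<le>p. - esym_even n (p - i) * Pvec n (k + i) s)"
    by (intro in_V_sum Pvec_in_V assms sym_ring_minus esym_even_sym)
  then show ?thesis by (simp add: xi_mat_def[abs_def] sum_negf)
qed

text \<open>The last vector is left out because only the first n - 1 stay independent under the
  specialisation.\<close>

definition low_span :: "nat \<Rightarrow> (nat \<Rightarrow> mpol) \<Rightarrow> bool" where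
  "low_span n f \<longleftrightarrow> (\<exists>d. (\<forall>j. d j \<in> sym_ring (2 * n)) \<and> f = (\<lambda>q. \<Sum>j<n - 1. d j * Pvec n j q))"

lemma low_span_0: "low_span n (\<lambda>q. 0)"
  unfolding low_span_def by (intro exI[of _ "\<lambda>_. 0"]) simp

lemma low_span_add_Pvec:
  assumes "low_span n f" "k < n - 1" "c \<in> sym_ring (2 * n)"
  shows "low_span n (\<lambda>q. f q + c * Pvec n k q)"
proof -
  obtain d where d: "\<And>j. d j \<in> sym_ring (2 * n)" "f = (\<lambda>q. \<Sum>j<n - 1. d j * Pvec n j q)"
    using assms(1) unfolding low_span_def by blast
  have "(\<Sum>j<n - 1. (if j = k then c else 0) * Pvec n j q) = c * Pvec n k q" for q
    using assms(2) by (subst sum.remove[of _ k]) auto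
  then have "(\<lambda>q. f q + c * Pvec n k q) = (\<lambda>q. \<Sum>j<n - 1. (d j + (if j = k then c else 0)) * Pvec n j q)"
    unfolding d(2) by (simp only: distrib_right sum.distrib)
  moreover have "\<forall>j. d j + (if j = k then c else 0) \<in> sym_ring (2 * n)"
    using d(1) assms(3) by auto
  ultimately show ?thesis
    unfolding low_span_def by (intro exI[of _ "\<lambda>j. d j + (if j = k then c else 0)"] conjI)
qed

text \<open>The row recursion trades one step in \<open>k\<close> for one step in \<open>p\<close>,
  until row \<open>n\<close> is reached, which is zero. The vectors met on the way have index below
  n - 1.\<close>

lemma xi_mat_row_high: "k < n \<Longrightarrow> p \<le> n \<Longrightarrow> k + p \<ge> n \<Longrightarrow> low_span n (xi_mat n k p)"
proof (induction k arbitrary: p)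
  case 0
  then have "xi_mat n 0 p = (\<lambda>q. 0)" by auto
  then show ?case by (simp add: low_span_0)
next
  case (Suc k)
  show ?case
  proof (cases "p = n")
    case True
    then have "xi_mat n (Suc k) p = (\<lambda>q. 0)" by auto
    then show ?thesis by (simp add: low_span_0)
  next
    case False
    have "xi_mat n (Suc k) p = (\<lambda>q. xi_mat n k (Suc p) q + esym_even n (Suc p) * Pvec n k q)"
      by (simp add: xi_mat_Suc_left fun_eq_iff)
    with Suc False show ?thesis by (auto intro!: low_span_add_Pvec)
  qed
qed

text \<open>The row recursion leads down to row 0 of index k + p, which is minus the vector of that
  index; it is the last vector exactly on the antidiagonal k + p = n - 1.\<close>

lemma xi_mat_row_low: "k + p < n \<Longrightarrow>
  low_span n (\<lambda>q. xi_mat n k p q + (if k + p = n - 1 then Pvec n (n - 1) q else 0))"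
proof (induction p arbitrary: k)
  case 0
  show ?case
  proof (cases "k = n - 1")
    case True
    then show ?thesis by (simp add: xi_mat_0_left low_span_0)
  next
    case False
    with 0 low_span_add_Pvec[OF low_span_0, of k n "- 1"] show ?thesis
      by (simp add: xi_mat_0_left sym_ring_minus)
  qed
next
  case (Suc p)
  have "low_span n (\<lambda>q. (xi_mat n (Suc k) p q + (if Suc k + p = n - 1 then Pvec n (n - 1) q else 0))
      + - esym_even n (Suc p) * Pvec n k q)"
    using Suc.IH[of "Suc k"] Suc.prems by (intro low_span_add_Pvec) auto
  then show ?case by (simp add: xi_mat_Suc_left algebra_simps)
qed

lemma xi_mat_row:
  assumes "k < n" "p < n"
  shows "low_span n (\<lambda>q. xi_mat n k p q + (if k + p = n - 1 then Pvec n (n - 1) q else 0))"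
proof (cases "k + p < n")
  case False
  then have "k + p \<noteq> n - 1" using assms by linarith
  with xi_mat_row_high[of k n p] assms False show ?thesis by simp
qed (rule xi_mat_row_low)

lemma xi_mat_rows:
  obtains d where "\<And>k p j. k < n \<Longrightarrow> p < n \<Longrightarrow> d k p j \<in> sym_ring (2 * n)"
    "\<And>k p q. k < n \<Longrightarrow> p < n \<Longrightarrow>
      xi_mat n k p q = (\<Sum>j<n - 1. d k p j * Pvec n j q) - (if k + p = n - 1 then Pvec n (n - 1) q else 0)"
proof -
  define P where "P k p d \<longleftrightarrow> (\<forall>j. d j \<in> sym_ring (2 * n)) \<and>
     (\<lambda>q. xi_mat n k p q + (if k + p = n - 1 then Pvec n (n - 1) q else 0)) =
     (\<lambda>q. \<Sum>j<n - 1. d j * Pvec n j q)" for k p d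
  define d where "d k p = (SOME d. P k p d)" for k p
  have P: "P k p (d k p)" if "k < n" "p < n" for k p
  proof -
    have "\<exists>d. P k p d" using xi_mat_row[OF that] unfolding low_span_def P_def .
    then show ?thesis unfolding d_def by (rule someI_ex)
  qed
  show ?thesis
  proof (rule that[of d])
    show "d k p j \<in> sym_ring (2 * n)" if "k < n" "p < n" for k p j
      using P[OF that] by (simp add: P_def)
    show "xi_mat n k p q = (\<Sum>j<n - 1. d k p j * Pvec n j q) - (if k + p = n - 1 then Pvec n (n - 1) q else 0)"
      if "k < n" "p < n" for k p q
      using P[OF that] by (simp add: P_def fun_eq_iff eq_diff_eq)
  qed
qed

subsection \<open>Matrices with rows and columns in the span\<close>

lemma Pvec_spans_V_family:
  assumes "n \<ge> 1" "\<And>p. p \<in> I \<Longrightarrow> in_V n (B p)"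
  obtains b where "\<And>p r. p \<in> I \<Longrightarrow> r < n \<Longrightarrow> b p r \<in> sym_ring (2 * n)"
    "\<And>p q. p \<in> I \<Longrightarrow> q < n \<Longrightarrow> B p q = (\<Sum>r<n. b p r * Pvec n r q)"
proof -
  define P where "P p b \<longleftrightarrow> (\<forall>r<n. b r \<in> sym_ring (2 * n)) \<and>
     (\<forall>q<n. B p q = (\<Sum>r<n. b r * Pvec n r q))" for p b
  define b where "b p = (SOME b. P p b)" for p
  have P: "P p (b p)" if p: "p \<in> I" for p
  proof -
    obtain c where "\<And>r. r < n \<Longrightarrow> c r \<in> sym_ring (2 * n)"
      "\<And>s. s < n \<Longrightarrow> B p s = (\<Sum>r<n. c r * Pvec n r s)"
      using Pvec_spans_V[OF assms(1) assms(2)[OF p]] by blast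
    then have "P p c" by (simp add: P_def)
    then show ?thesis unfolding b_def by (rule someI[of "P p" c])
  qed
  show ?thesis
    by (rule that[of b]) (use P in \<open>auto simp: P_def\<close>)
qed

lemma sum_lessThan_pred:
  fixes f :: "nat \<Rightarrow> 'a::comm_monoid_add"
  assumes "n \<ge> 1"
  shows "(\<Sum>r<n. f r) = (\<Sum>r<n - 1. f r) + f (n - 1)"
  using assms by (cases n) simp_all

lemma block_span:
  assumes n: "n \<ge> 1"
    and rows: "\<And>p. p < n \<Longrightarrow> in_V n (B p)"
    and cols: "\<And>q. q < n \<Longrightarrow> in_V n (\<lambda>p. B p q)"
  obtains \<beta> d where "\<And>k. k < n \<Longrightarrow> \<beta> k \<in> sym_ring (2 * n)"
    "\<And>j r. j < n \<Longrightarrow> r < n - 1 \<Longrightarrow> d j r \<in> sym_ring (2 * n)"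
    "\<And>p q. p < n \<Longrightarrow> q < n \<Longrightarrow>
      B p q = (\<Sum>k<n. \<beta> k * xi_mat n k p q) + (\<Sum>r<n - 1. \<Sum>j<n. d j r * (Pvec n j p * Pvec n r q))"
proof -
  obtain b where b: "\<And>p r. p \<in> {..<n} \<Longrightarrow> r < n \<Longrightarrow> b p r \<in> sym_ring (2 * n)"
    "\<And>p q. p \<in> {..<n} \<Longrightarrow> q < n \<Longrightarrow> B p q = (\<Sum>r<n. b p r * Pvec n r q)"
    using Pvec_spans_V_family[OF n, of "{..<n}" B] rows by blast
  obtain e where e: "\<And>k p j. k < n \<Longrightarrow> p < n \<Longrightarrow> e k p j \<in> sym_ring (2 * n)"
    "\<And>k p q. k < n \<Longrightarrow> p < n \<Longrightarrow>
      xi_mat n k p q = (\<Sum>j<n - 1. e k p j * Pvec n j q) - (if k + p = n - 1 then Pvec n (n - 1) q else 0)"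
    using xi_mat_rows[of n] by blast
  \<comment> \<open>Row n - 1 - k involves the last vector in \<open>xi_mat n k\<close> only, with
    coefficient -1. So \<open>\<gamma> k\<close> is read off from that row and no division
    occurs.\<close>
  define \<gamma> where "\<gamma> k = b (n - 1 - k) (n - 1)" for k
  have \<gamma>: "\<gamma> k \<in> sym_ring (2 * n)" for k
    unfolding \<gamma>_def using n by (intro b(1)) auto
  define B' where "B' p q = B p q + (\<Sum>k<n. \<gamma> k * xi_mat n k p q)" for p q
  define b' where "b' p r = b p r + (\<Sum>k<n. \<gamma> k * e k p r)" for p r
  have b': "b' p r \<in> sym_ring (2 * n)" if "p < n" "r < n" for p r
    unfolding b'_def using that b(1) e(1) \<gamma> by (intro sym_ring_add sym_ring_sum sym_ring_mult) auto
  have B': "B' p q = (\<Sum>r<n - 1. b' p r * Pvec n r q)" if p: "p < n" and q: "q < n" for p q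
  proof -
    have "(\<Sum>k<n. \<gamma> k * (if k + p = n - 1 then Pvec n (n - 1) q else 0)) =
        (\<Sum>k<n. if k = n - 1 - p then \<gamma> k * Pvec n (n - 1) q else 0)"
      using p by (intro sum.cong refl) auto
    also have "\<dots> = b p (n - 1) * Pvec n (n - 1) q"
      using p by (simp add: \<gamma>_def)
    finally have *: "(\<Sum>k<n. \<gamma> k * (if k + p = n - 1 then Pvec n (n - 1) q else 0)) =
        b p (n - 1) * Pvec n (n - 1) q" .
    have "(\<Sum>k<n. \<gamma> k * xi_mat n k p q) =
        (\<Sum>k<n. \<Sum>j<n - 1. \<gamma> k * e k p j * Pvec n j q) - b p (n - 1) * Pvec n (n - 1) q"
      unfolding *[symmetric] using p e(2)
      by (simp add: right_diff_distrib sum_subtractf sum_distrib_left mult_ac)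
    also have "(\<Sum>k<n. \<Sum>j<n - 1. \<gamma> k * e k p j * Pvec n j q) =
        (\<Sum>j<n - 1. (\<Sum>k<n. \<gamma> k * e k p j) * Pvec n j q)"
      unfolding sum_distrib_right by (rule sum.swap)
    finally show ?thesis
      using b(2)[of p q] p q sum_lessThan_pred[OF n, of "\<lambda>r. b p r * Pvec n r q"]
      by (simp add: B'_def b'_def distrib_right sum.distrib)
  qed
  \<comment> \<open>Subtraction keeps the columns in V, because the columns of the symmetric
    \<open>xi_mat\<close> are also its rows.\<close>
  have colsB': "in_V n (\<lambda>p. B' p q)" if "q < n" for q
    unfolding B'_def using \<gamma> that
    by (intro in_V_add cols in_V_sum) (simp_all add: xi_mat_commute[of n _ _ q] xi_mat_in_V[OF n])
  have "in_V n (\<lambda>p. b' p r)" if r: "r < n - 1" for r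
  proof -
    \<comment> \<open>The column condition on \<open>B'\<close> is a specialised relation between
      the first n - 1 vectors, with the values of the columns of \<open>b'\<close> as
      coefficients.\<close>
    have "spec (2 * n) (tail_eval n (\<lambda>p. b' p r)) = 0"
    proof (rule spec_Pvec_independent[OF _ r])
      fix s assume s: "s < n - 1"
      have "(\<Sum>r<n - 1. tail_eval n (\<lambda>p. b' p r) * Pvec n r s) = tail_eval n (\<lambda>p. \<Sum>r<n - 1. b' p r * Pvec n r s)"
        by (rule tail_eval_sum[symmetric])
      also have "\<dots> = tail_eval n (\<lambda>p. B' p s)"
        using s by (intro tail_eval_cong) (simp add: B')
      finally show "spec (2 * n) (\<Sum>r<n - 1. tail_eval n (\<lambda>p. b' p r) * Pvec n r s) = 0"
        using colsB'[of s] s by (simp only: in_V_def)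
    qed
    then show ?thesis using b' r by (simp add: in_V_def)
  qed
  then have V: "in_V n ((\<lambda>r p. b' p r) r)" if "r \<in> {..<n - 1}" for r
    using that by simp
  obtain d where d: "\<And>r j. r \<in> {..<n - 1} \<Longrightarrow> j < n \<Longrightarrow> d r j \<in> sym_ring (2 * n)"
    "\<And>r p. r \<in> {..<n - 1} \<Longrightarrow> p < n \<Longrightarrow> b' p r = (\<Sum>j<n. d r j * Pvec n j p)"
    by (rule Pvec_spans_V_family[where I = "{..<n - 1}" and B = "\<lambda>r p. b' p r", OF n V])
      (assumption, rule that, assumption+)
  show ?thesis
  proof (rule that[of "\<lambda>k. - \<gamma> k" "\<lambda>j r. d r j"])
    fix p q assume pq: "p < n" "q < n"
    have "B p q = B' p q - (\<Sum>k<n. \<gamma> k * xi_mat n k p q)" by (simp add: B'_def)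
    also have "B' p q = (\<Sum>r<n - 1. \<Sum>j<n. d r j * (Pvec n j p * Pvec n r q))"
      using pq by (simp add: B' d sum_distrib_right mult.assoc)
    finally show "B p q = (\<Sum>k<n. - \<gamma> k * xi_mat n k p q) + (\<Sum>r<n - 1. \<Sum>j<n. d r j * (Pvec n j p * Pvec n r q))"
      by (simp add: sum_negf)
  qed (use \<gamma> d in auto)
qed

text \<open>The combination of the symmetric \<open>xi_mat\<close> cancels in A(p,q) - A(q,p) = 2
  A(p,q).\<close>

lemma antisymmetric_block_span:
  assumes n: "n \<ge> 1"
    and rows: "\<And>p. p < n \<Longrightarrow> in_V n (A p)"
    and anti: "\<And>p q. A p q = - A q p"
  obtains \<alpha> where "\<And>i j. i < n \<Longrightarrow> j < n \<Longrightarrow> \<alpha> i j \<in> sym_ring (2 * n)"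
    "\<And>i j. \<alpha> i j = - \<alpha> j i" "\<And>i. \<alpha> i i = 0"
    "\<And>p q. p < n \<Longrightarrow> q < n \<Longrightarrow> A p q = (\<Sum>j<n. \<Sum>i<n. \<alpha> i j * (Pvec n i p * Pvec n j q))"
proof -
  have cols: "in_V n (\<lambda>p. A p q)" if "q < n" for q
  proof -
    have "in_V n (\<lambda>p. - 1 * A q p)"
      using rows that by (intro in_V_mult sym_ring_minus) auto
    moreover have "(\<lambda>p. A p q) = (\<lambda>p. - 1 * A q p)"
      using anti[of _ q] by (simp add: fun_eq_iff)
    ultimately show ?thesis by simp
  qed
  obtain \<beta> d where d: "\<And>k. k < n \<Longrightarrow> \<beta> k \<in> sym_ring (2 * n)"
    "\<And>j r. j < n \<Longrightarrow> r < n - 1 \<Longrightarrow> d j r \<in> sym_ring (2 * n)"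
    "\<And>p q. p < n \<Longrightarrow> q < n \<Longrightarrow>
      A p q = (\<Sum>k<n. \<beta> k * xi_mat n k p q) + (\<Sum>r<n - 1. \<Sum>j<n. d j r * (Pvec n j p * Pvec n r q))"
    using block_span[OF n rows cols] by blast
  \<comment> \<open>Padding with zeros lets both indices run below \<open>n\<close>, so that they
    can be exchanged.\<close>
  define d' where "d' j r = (if r < n - 1 then d j r else 0)" for j r
  define \<alpha> where "\<alpha> i j = const (1 / 2) * (d' i j - d' j i)" for i j
  let ?S = "\<lambda>p q. \<Sum>r<n. \<Sum>j<n. d' j r * (Pvec n j p * Pvec n r q)"
  have S: "A p q = (\<Sum>k<n. \<beta> k * xi_mat n k p q) + ?S p q" if "p < n" "q < n" for p q
    using d(3)[OF that] sum_lessThan_pred[OF n, of "\<lambda>r. \<Sum>j<n. d' j r * (Pvec n j p * Pvec n r q)"]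
    by (simp add: d'_def)
  have half: "const (1 / 2) * (x + x) = x" for x
    by (rule ev_inject) (simp only: ev_mult ev_add ev_const, simp)
  have "A p q = (\<Sum>j<n. \<Sum>i<n. \<alpha> i j * (Pvec n i p * Pvec n j q))" if pq: "p < n" "q < n" for p q
  proof -
    have "A p q + A p q = A p q - A q p" using anti[of p q] by simp
    also have "\<dots> = ?S p q - ?S q p"
      using S[OF pq] S[OF pq(2,1)] by (simp add: xi_mat_commute[of n _ q p])
    also have "?S q p = (\<Sum>j<n. \<Sum>r<n. d' j r * (Pvec n j q * Pvec n r p))" by (rule sum.swap)
    also have "?S p q - \<dots> = (\<Sum>j<n. \<Sum>i<n. (d' i j - d' j i) * (Pvec n i p * Pvec n j q))"
      by (simp add: sum_subtractf[symmetric] algebra_simps)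
    finally have "const (1 / 2) * (A p q + A p q) =
      const (1 / 2) * (\<Sum>j<n. \<Sum>i<n. (d' i j - d' j i) * (Pvec n i p * Pvec n j q))" by simp
    then show ?thesis unfolding half by (simp add: \<alpha>_def sum_distrib_left mult.assoc)
  qed
  moreover have "\<alpha> i j \<in> sym_ring (2 * n)" if "i < n" "j < n" for i j
    unfolding \<alpha>_def d'_def using that d(2) by (auto intro!: sym_ring_mult sym_ring_diff)
  moreover have "\<alpha> i j = - \<alpha> j i" for i j by (simp add: \<alpha>_def algebra_simps)
  moreover have "\<alpha> i i = 0" for i by (simp add: \<alpha>_def)
  ultimately show ?thesis using that by blast
qed

lemma sum_antisymmetric:
  fixes \<alpha> :: "nat \<Rightarrow> nat \<Rightarrow> 'a::comm_ring_1"
  assumes "\<And>i j. \<alpha> i j = - \<alpha> j i" "\<And>i. \<alpha> i i = 0"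
  shows "(\<Sum>j<n. \<Sum>i<n. \<alpha> i j * F i j) = (\<Sum>j<n. \<Sum>i<j. \<alpha> i j * (F i j - F j i))"
proof (induction n)
  case (Suc n)
  have "(\<Sum>j<n. \<alpha> n j * F n j) = - (\<Sum>j<n. \<alpha> j n * F n j)"
    by (subst assms(1)) (simp add: sum_negf)
  with Suc show ?case
    by (simp add: assms(2) sum.distrib right_diff_distrib sum_subtractf)
qed simp

text \<open>Independence of the vectors is applied first in the index \<open>q\<close> and then in
  \<open>p\<close>.\<close>

lemma tensor_independent:
  assumes n: "n \<ge> 1"
    and 0: "\<And>p q. p < n \<Longrightarrow> q < n \<Longrightarrow> (\<Sum>j<n. \<Sum>i<n. \<alpha> i j * (Pvec n i p * Pvec n j q)) = 0"
    and "i < n" "j < n"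
  shows "\<alpha> i j = 0"
proof -
  have "(\<Sum>i<n. \<alpha> i j * Pvec n i p) = 0" if p: "p < n" for p
  proof (rule Pvec_independent[OF n _ \<open>j < n\<close>])
    fix q assume "q < n"
    with 0[OF p this] show "(\<Sum>j<n. (\<Sum>i<n. \<alpha> i j * Pvec n i p) * Pvec n j q) = 0"
      by (simp add: sum_distrib_right mult.assoc)
  qed
  from Pvec_independent[OF n this \<open>i < n\<close>] show ?thesis .
qed

lemma antisymmetric_independent:
  assumes n: "n \<ge> 1"
    and 0: "\<And>p q. p < n \<Longrightarrow> q < n \<Longrightarrow>
      (\<Sum>j<n. \<Sum>i<j. c i j * (Pvec n i p * Pvec n j q - Pvec n j p * Pvec n i q)) = 0"
    and ij: "i < j" "j < n"
  shows "c i j = 0"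
proof -
  define \<alpha> where "\<alpha> i j = (if i < j then c i j else if j < i then - c j i else 0)" for i j
  have anti: "\<alpha> i j = - \<alpha> j i" "\<alpha> i i = 0" for i j by (auto simp: \<alpha>_def)
  have "\<alpha> i j = 0"
  proof (rule tensor_independent[OF n])
    fix p q assume "p < n" "q < n"
    have "(\<Sum>j<n. \<Sum>i<n. \<alpha> i j * (Pvec n i p * Pvec n j q)) =
        (\<Sum>j<n. \<Sum>i<j. \<alpha> i j * (Pvec n i p * Pvec n j q - Pvec n j p * Pvec n i q))"
      using anti by (rule sum_antisymmetric)
    also have "\<dots> = 0" using 0[OF \<open>p < n\<close> \<open>q < n\<close>] by (simp add: \<alpha>_def)
    finally show "(\<Sum>j<n. \<Sum>i<n. \<alpha> i j * (Pvec n i p * Pvec n j q)) = 0" .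
  qed (use ij in auto)
  with ij show ?thesis by (simp add: \<alpha>_def)
qed

text \<open>In row n - 1 - k the last vector occurs only through \<open>xi_mat n k\<close>, with
  total coefficient \<open>- \<beta> k\<close>, so all \<open>\<beta> k\<close> vanish. A relation
  between products of vectors remains.\<close>

lemma mixed_independent:
  assumes n: "n \<ge> 1"
    and 0: "\<And>p q. p < n \<Longrightarrow> q < n \<Longrightarrow>
      (\<Sum>k<n. \<beta> k * xi_mat n k p q) + (\<Sum>r<n - 1. \<Sum>j<n. d j r * (Pvec n j p * Pvec n r q)) = 0"
  shows "k < n \<Longrightarrow> \<beta> k = 0" and "j < n \<Longrightarrow> r < n - 1 \<Longrightarrow> d j r = 0"
proof -
  obtain e where e: "\<And>k p j. k < n \<Longrightarrow> p < n \<Longrightarrow> e k p j \<in> sym_ring (2 * n)"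
    "\<And>k p q. k < n \<Longrightarrow> p < n \<Longrightarrow>
      xi_mat n k p q = (\<Sum>j<n - 1. e k p j * Pvec n j q) - (if k + p = n - 1 then Pvec n (n - 1) q else 0)"
    using xi_mat_rows[of n] by blast
  have \<beta>: "\<beta> k = 0" if k: "k < n" for k
  proof -
    define p where "p = n - 1 - k"
    have p: "p < n" using n by (simp add: p_def)
    define c where "c r = (if r < n - 1 then (\<Sum>k<n. \<beta> k * e k p r) + (\<Sum>j<n. d j r * Pvec n j p)
       else - \<beta> k)" for r
    have "c (n - 1) = 0"
    proof (rule Pvec_independent[OF n])
      fix q assume q: "q < n"
      have "(\<Sum>k<n. \<beta> k * (if k + p = n - 1 then Pvec n (n - 1) q else 0)) =
          (\<Sum>i<n. if i = k then \<beta> k * Pvec n (n - 1) q else 0)"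
        using k by (intro sum.cong refl) (auto simp: p_def)
      also have "\<dots> = \<beta> k * Pvec n (n - 1) q" using k by simp
      finally have *: "(\<Sum>k<n. \<beta> k * (if k + p = n - 1 then Pvec n (n - 1) q else 0)) =
          \<beta> k * Pvec n (n - 1) q" .
      have "(\<Sum>k<n. \<beta> k * xi_mat n k p q) =
          (\<Sum>k<n. \<Sum>j<n - 1. \<beta> k * e k p j * Pvec n j q) - \<beta> k * Pvec n (n - 1) q"
        unfolding *[symmetric] using p e(2)
        by (simp add: right_diff_distrib sum_subtractf sum_distrib_left mult_ac)
      also have "(\<Sum>k<n. \<Sum>j<n - 1. \<beta> k * e k p j * Pvec n j q) =
          (\<Sum>j<n - 1. (\<Sum>k<n. \<beta> k * e k p j) * Pvec n j q)"
        unfolding sum_distrib_right by (rule sum.swap)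
      finally have xi_mat: "(\<Sum>k<n. \<beta> k * xi_mat n k p q) =
          (\<Sum>j<n - 1. (\<Sum>k<n. \<beta> k * e k p j) * Pvec n j q) - \<beta> k * Pvec n (n - 1) q" .
      have d: "(\<Sum>r<n - 1. \<Sum>j<n. d j r * (Pvec n j p * Pvec n r q)) =
          (\<Sum>r<n - 1. (\<Sum>j<n. d j r * Pvec n j p) * Pvec n r q)"
        by (simp add: sum_distrib_right mult.assoc)
      have "(\<Sum>r<n. c r * Pvec n r q) =
          (\<Sum>r<n - 1. ((\<Sum>k<n. \<beta> k * e k p r) + (\<Sum>j<n. d j r * Pvec n j p)) * Pvec n r q)
          - \<beta> k * Pvec n (n - 1) q"
        unfolding sum_lessThan_pred[OF n, of "\<lambda>r. c r * Pvec n r q"] by (simp add: c_def)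
      also have "\<dots> = (\<Sum>k<n. \<beta> k * xi_mat n k p q) + (\<Sum>r<n - 1. \<Sum>j<n. d j r * (Pvec n j p * Pvec n r q))"
        unfolding xi_mat d distrib_right sum.distrib by (simp only: algebra_simps)
      also have "\<dots> = 0" by (rule 0[OF p q])
      finally show "(\<Sum>r<n. c r * Pvec n r q) = 0" .
    qed (use n in auto)
    then show ?thesis by (simp add: c_def)
  qed
  then show "k < n \<Longrightarrow> \<beta> k = 0" by blast
  assume jr: "j < n" "r < n - 1"
  have "(if r < n - 1 then d j r else 0) = 0"
  proof (rule tensor_independent[OF n, of "\<lambda>j r. if r < n - 1 then d j r else 0"])
    fix p q assume "p < n" "q < n"
    from 0[OF this] sum_lessThan_pred[OF n, of "\<lambda>r. \<Sum>j<n. (if r < n - 1 then d j r else 0) * (Pvec n j p * Pvec n r q)"]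
    show "(\<Sum>r<n. \<Sum>j<n. (if r < n - 1 then d j r else 0) * (Pvec n j p * Pvec n r q)) = 0"
      by (simp add: \<beta>)
  qed (use jr in auto)
  with jr show "d j r = 0" by simp
qed


subsection \<open>Coefficients of polynomials in two variables\<close>

abbreviation co :: "'a::zero poly poly \<Rightarrow> nat \<Rightarrow> nat \<Rightarrow> 'a" where
  "co P i j \<equiv> coeff (coeff P i) j"

lemma co_eqI: "(\<And>i j. co P i j = co Q i j) \<Longrightarrow> P = Q"
  by (intro poly_eqI) simp

lemma coeff_in_X1: "coeff (in_X1 f) i = [:coeff f i:]"
  by (simp add: in_X1_def coeff_map_poly)

lemma co_in_X1_in_X2: "co (in_X1 f * in_X2 g) i j = coeff f i * coeff g j"
  by (simp add: in_X2_def coeff_in_X1 mult.commute[of _ "[:g:]"] coeff_mult_0)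

lemma co_wedge: "co (wedge f g) i j = coeff f i * coeff g j - coeff f j * coeff g i"
  by (simp add: wedge_def co_in_X1_in_X2 mult.commute[of "in_X2 f"] mult.commute[of "coeff g i"])

lemma co_scale: "co (scale c P) i j = c * co P i j"
  by (simp add: scale_def)

lemma co_sum: "co (sum f I) i j = (\<Sum>x\<in>I. co (f x) i j)"
  by (simp add: coeff_sum)

lemma co_X1_mult: "co (X1 * P) i j = (if i = 0 then 0 else co P (i - 1) j)"
  by (cases i) (simp_all add: X1_def)

lemma co_X2_mult: "co (X2 * P) i j = (if j = 0 then 0 else co P i (j - 1))"
  by (cases j) (simp_all add: X2_def)

lemma coeff_v: "coeff (v n (Suc r)) i = (if even i then Pvec n r (i div 2) else 0)"
proof -
  have "v n (Suc r) = (\<Sum>s<n. monom (Pvec n r s) (2 * s))"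
    unfolding v_def One_nat_def sum.atLeast1_atMost_eq by (intro sum.cong refl) (simp add: Pvec_def add.commute)
  then have "coeff (v n (Suc r)) i = (\<Sum>s<n. if 2 * s = i then Pvec n r s else 0)"
    by (simp add: coeff_sum)
  also have "\<dots> = (\<Sum>s<n. if s = i div 2 then (if even i then Pvec n r s else 0) else 0)"
    by (intro sum.cong refl) auto
  also have "\<dots> = (if even i then Pvec n r (i div 2) else 0)" by simp
  finally show ?thesis .
qed

lemma coeff_w: "coeff (w n (Suc r)) i = (if odd i then Pvec n r (i div 2) else 0)"
  by (cases i) (auto simp: w_def coeff_v)

lemma coeff_v0: "coeff (v0 n) i = (if even i then esym_even n (i div 2) else 0)"
proof -
  have "coeff (v0 n) i = (\<Sum>j\<le>n. if 2 * j = i then esym_even n j else 0)"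
    by (simp add: v0_def coeff_sum esym_even_def atLeast0AtMost cong: if_cong)
  also have "\<dots> = (\<Sum>j\<le>n. if j = i div 2 then (if even i then esym_even n j else 0) else 0)"
    by (intro sum.cong refl) auto
  also have "\<dots> = (if even i then esym_even n (i div 2) else 0)" by simp
  finally show ?thesis .
qed

lemma nat_parity_cases:
  obtains p where "i = 2 * p" | p where "i = Suc (2 * p)"
  by (metis odd_two_times_div_two_succ evenE Suc_eq_plus1)

lemma nat_parity_cases_Suc:
  obtains "i = 0" | "i = Suc 0" | p where "i = Suc (Suc (2 * p))" | p where "i = Suc (Suc (Suc (2 * p)))"
proof (cases i rule: nat_parity_cases)
  case (1 p)
  with that show ?thesis by (cases p) auto
next
  case (2 p)
  with that show ?thesis by (cases p) auto
qed

text \<open>A polynomial with these coefficients exists because \<open>xi_mat\<close> vanishes as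
  soon as an index reaches \<open>n\<close>.\<close>

lemma exists_co:
  obtains P where "\<And>i j. co P i j = (if even i \<and> even j then xi_mat n k (i div 2) (j div 2) else 0)"
proof -
  define P where "P = (\<Sum>p<n. \<Sum>q<n. monom (monom (xi_mat n k p q) (2 * q)) (2 * p))"
  have "co P i j = (if even i \<and> even j then xi_mat n k (i div 2) (j div 2) else 0)" for i j
  proof -
    have "co P i j = (\<Sum>p<n. if 2 * p = i then \<Sum>q<n. if 2 * q = j then xi_mat n k p q else 0 else 0)"
      unfolding P_def co_sum by (intro sum.cong refl) (auto simp: coeff_monom)
    also have "\<dots> = (if even i \<and> even j then xi_mat n k (i div 2) (j div 2) else 0)"
      by (cases i rule: nat_parity_cases; cases j rule: nat_parity_cases)
         (simp_all add: double_not_eq_Suc_double cong: if_cong)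
    finally show ?thesis .
  qed
  then show ?thesis by (rule that)
qed

text \<open>With the denominator cleared, \<open>\<xi>\<^sub>k\<close> satisfies
  \<open>(X\<^sub>1 + X\<^sub>2) \<xi>\<^sub>k = X\<^sub>1 v\<^sub>0(X\<^sub>2) w\<^sub>k(X\<^sub>1) - X\<^sub>2 v\<^sub>0(X\<^sub>1) w\<^sub>k(X\<^sub>2)\<close>, whose right-hand side is
  \<open>X\<^sub>2\<^sup>2 - X\<^sub>1\<^sup>2\<close> times the even polynomial with coefficient matrix \<^term>\<open>xi_mat n k\<close>.\<close>

lemma co_xi:
  "co (xi n (Suc k)) i j =
    (if even i \<and> odd j then xi_mat n k (i div 2) (j div 2)
     else if odd i \<and> even j then - xi_mat n k (i div 2) (j div 2) else 0)"
proof -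
  obtain H where H: "\<And>i j. co H i j = (if even i \<and> even j then xi_mat n k (i div 2) (j div 2) else 0)"
    using exists_co by blast
  have xi_mat0: "xi_mat n k p 0 = - Pvec n k p" for p by (simp add: xi_mat_commute[of n k p] xi_mat_0_left)
  have key: "X2 * (X2 * H) - X1 * (X1 * H) =
      X1 * (in_X1 (w n (Suc k)) * in_X2 (v0 n)) - X2 * (in_X1 (v0 n) * in_X2 (w n (Suc k)))"
  proof (rule co_eqI)
    fix i j
    show "co (X2 * (X2 * H) - X1 * (X1 * H)) i j =
      co (X1 * (in_X1 (w n (Suc k)) * in_X2 (v0 n)) - X2 * (in_X1 (v0 n) * in_X2 (w n (Suc k)))) i j"
      \<comment> \<open>At even exponents from 2 on, the identity is the difference of the row and
        column recursions, where the terms with \<open>Suc k\<close> cancel. Exponents 0 and 1 form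
        the boundary.\<close>
      by (cases i rule: nat_parity_cases_Suc; cases j rule: nat_parity_cases_Suc)
         (simp_all add: co_X1_mult co_X2_mult co_in_X1_in_X2 H coeff_w coeff_v0
           xi_mat_Suc_left xi_mat_Suc_right xi_mat_0_left xi_mat0 mult.commute[of "esym_even n _"])
  qed
  have "is_xi n (Suc k) ((X2 - X1) * H)"
  proof -
    have "(X1 + X2) * (2 * ((X2 - X1) * H)) = 2 * (X2 * (X2 * H) - X1 * (X1 * H))"
      by (simp add: algebra_simps)
    also have "\<dots> = (X1 - X2) * (in_X1 (v0 n) * in_X2 (w n (Suc k)) + in_X2 (v0 n) * in_X1 (w n (Suc k)))
       + (X1 + X2) * (- in_X1 (v0 n) * in_X2 (w n (Suc k)) + in_X2 (v0 n) * in_X1 (w n (Suc k)))"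
      unfolding key by (simp add: algebra_simps)
    finally show ?thesis unfolding is_xi_def .
  qed
  then have xi: "xi n (Suc k) = X2 * H - X1 * H"
    using xi_ex1 xi_equation by (metis left_diff_distrib)
  show ?thesis
    by (cases i rule: nat_parity_cases; cases j rule: nat_parity_cases)
       (auto simp: xi co_X1_mult co_X2_mult H)
qed

subsection \<open>Characterisation of the module\<close>

lemma spec_tail_eval_eq_0_iff:
  assumes "n \<ge> 1"
  shows "spec (2 * n) (tail_eval n g) = 0 \<longleftrightarrow>
    (\<forall>a. a (2 * n) = - a (2 * n - 1) \<and> a (2 * n - 1) \<noteq> 0 \<longrightarrow>
      (\<Sum>s<n. ev a (g s) * inverse (a (2 * n - 1)) ^ (2 * s)) = 0)"
proof -
  have *: "ev a (tail_eval n g) = a (2 * n - 1) ^ (2 * (n - 1)) *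
      (\<Sum>s<n. ev a (g s) * inverse (a (2 * n - 1)) ^ (2 * s))" if a: "a (2 * n - 1) \<noteq> 0" for a
    unfolding tail_eval_def ev_sum sum_distrib_left
  proof (intro sum.cong refl)
    fix s assume "s \<in> {..<n}"
    then have "s \<le> n - 1" by auto
    from power_diff_inverse[OF a this]
    show "ev a (g s * xvar (2 * n - 1) ^ (2 * (n - 1 - s))) =
        a (2 * n - 1) ^ (2 * (n - 1)) * (ev a (g s) * inverse (a (2 * n - 1)) ^ (2 * s))"
      by (simp only: ev_mult ev_power ev_xvar mult_ac)
  qed
  show ?thesis
  proof
    assume 0: "spec (2 * n) (tail_eval n g) = 0"
    show "\<forall>a. a (2 * n) = - a (2 * n - 1) \<and> a (2 * n - 1) \<noteq> 0 \<longrightarrow>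
        (\<Sum>s<n. ev a (g s) * inverse (a (2 * n - 1)) ^ (2 * s)) = 0"
    proof (intro allI impI)
      fix a :: "nat \<Rightarrow> complex" assume a: "a (2 * n) = - a (2 * n - 1) \<and> a (2 * n - 1) \<noteq> 0"
      with *[of a] spec_eq_0D[OF 0, of a]
      show "(\<Sum>s<n. ev a (g s) * inverse (a (2 * n - 1)) ^ (2 * s)) = 0" by simp
    qed
  next
    assume 0: "\<forall>a. a (2 * n) = - a (2 * n - 1) \<and> a (2 * n - 1) \<noteq> 0 \<longrightarrow>
        (\<Sum>s<n. ev a (g s) * inverse (a (2 * n - 1)) ^ (2 * s)) = 0"
    show "spec (2 * n) (tail_eval n g) = 0"
    proof (rule spec_eq_0I)
      fix a :: "nat \<Rightarrow> complex" assume a: "a (2 * n) = - a (2 * n - 1)" "a (2 * n - 1) \<noteq> 0"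
      show "ev a (tail_eval n g) = 0" unfolding *[of a, OF a(2)] using 0 a by simp
    qed (use assms in simp)
  qed
qed

lemma sum_even_odd_lessThan:
  fixes f :: "nat \<Rightarrow> 'a::comm_monoid_add"
  shows "(\<Sum>k<2 * n. f k) = (\<Sum>s<n. f (2 * s)) + (\<Sum>s<n. f (2 * s + 1))"
  by (induction n) (simp_all add: ac_simps)

text \<open>Passing from t to -t keeps the even part and negates the odd part, so vanishing at both
  points means that both parts vanish.\<close>

lemma row_vanishing_iff:
  assumes n: "n \<ge> 1" and deg: "\<And>k. k \<ge> 2 * n \<Longrightarrow> coeff f k = 0"
  shows "(\<forall>a x. x \<noteq> 0 \<longrightarrow>
      poly (map_poly (ev (a(2 * n - 1 := x, 2 * n := - x))) f) (inverse x) = 0 \<and>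
      poly (map_poly (ev (a(2 * n - 1 := x, 2 * n := - x))) f) (- inverse x) = 0) \<longleftrightarrow>
    spec (2 * n) (tail_eval n (\<lambda>s. coeff f (2 * s))) = 0 \<and>
    spec (2 * n) (tail_eval n (\<lambda>s. coeff f (2 * s + 1))) = 0"
proof -
  define S0 where "S0 a t = (\<Sum>s<n. ev a (coeff f (2 * s)) * t ^ (2 * s))" for a t
  define S1 where "S1 a t = (\<Sum>s<n. ev a (coeff f (2 * s + 1)) * t ^ (2 * s))" for a t
  have P: "poly (map_poly (ev a) f) t = S0 a t + t * S1 a t" for a t
  proof -
    have "degree (map_poly (ev a) f) \<le> 2 * n - 1"
      by (rule degree_le) (use deg in \<open>auto simp: coeff_map_poly\<close>)
    then have "poly (map_poly (ev a) f) t = (\<Sum>k\<le>2 * n - 1. ev a (coeff f k) * t ^ k)"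
      by (subst poly_as_sum_of_monoms'[symmetric])
        (simp_all only: poly_sum poly_monom coeff_map_poly ev_0)
    also have "{..2 * n - 1} = {..<2 * n}" using n by auto
    finally show ?thesis
      unfolding sum_even_odd_lessThan by (simp add: S0_def S1_def sum_distrib_left mult_ac)
  qed
  have even: "S0 a (- t) = S0 a t" "S1 a (- t) = S1 a t" for a t
    by (simp_all add: S0_def S1_def)
  have *: "poly (map_poly (ev a) f) t = 0 \<and> poly (map_poly (ev a) f) (- t) = 0 \<longleftrightarrow>
      S0 a t = 0 \<and> S1 a t = 0" if "t \<noteq> 0" for a t
    unfolding P even using that by (auto simp: add_eq_0_iff2)
  \<comment> \<open>The overwritten points are exactly the points whose last two coordinates are
    nonzero and opposite.\<close>
  have **: "(\<forall>a x. x \<noteq> 0 \<longrightarrow> Q (a(2 * n - 1 := x, 2 * n := - x)) x) \<longleftrightarrow>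
      (\<forall>a. a (2 * n) = - a (2 * n - 1) \<and> a (2 * n - 1) \<noteq> 0 \<longrightarrow> Q a (a (2 * n - 1)))"
    for Q :: "(nat \<Rightarrow> complex) \<Rightarrow> complex \<Rightarrow> bool"
  proof (intro iffI allI impI)
    fix a :: "nat \<Rightarrow> complex"
    assume Q: "\<forall>a x. x \<noteq> 0 \<longrightarrow> Q (a(2 * n - 1 := x, 2 * n := - x)) x"
      and a: "a (2 * n) = - a (2 * n - 1) \<and> a (2 * n - 1) \<noteq> 0"
    have "a(2 * n - 1 := a (2 * n - 1), 2 * n := - a (2 * n - 1)) = a" using a by auto
    with Q a show "Q a (a (2 * n - 1))" by metis
  next
    fix a :: "nat \<Rightarrow> complex" and x :: complex
    assume Q: "\<forall>a. a (2 * n) = - a (2 * n - 1) \<and> a (2 * n - 1) \<noteq> 0 \<longrightarrow> Q a (a (2 * n - 1))"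
      and x: "x \<noteq> 0"
    have "(a(2 * n - 1 := x, 2 * n := - x)) (2 * n) = - x"
      "(a(2 * n - 1 := x, 2 * n := - x)) (2 * n - 1) = x" using n by auto
    with Q x show "Q (a(2 * n - 1 := x, 2 * n := - x)) x" by metis
  qed
  have "(\<forall>a x. x \<noteq> 0 \<longrightarrow>
      poly (map_poly (ev (a(2 * n - 1 := x, 2 * n := - x))) f) (inverse x) = 0 \<and>
      poly (map_poly (ev (a(2 * n - 1 := x, 2 * n := - x))) f) (- inverse x) = 0) \<longleftrightarrow>
    (\<forall>a x. x \<noteq> 0 \<longrightarrow> S0 (a(2 * n - 1 := x, 2 * n := - x)) (inverse x) = 0 \<and>
      S1 (a(2 * n - 1 := x, 2 * n := - x)) (inverse x) = 0)"
    using * by (metis nonzero_imp_inverse_nonzero)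
  also have "\<dots> \<longleftrightarrow> (\<forall>a. a (2 * n) = - a (2 * n - 1) \<and> a (2 * n - 1) \<noteq> 0 \<longrightarrow>
      S0 a (inverse (a (2 * n - 1))) = 0 \<and> S1 a (inverse (a (2 * n - 1))) = 0)"
    by (rule **)
  also have "\<dots> \<longleftrightarrow> spec (2 * n) (tail_eval n (\<lambda>s. coeff f (2 * s))) = 0 \<and>
    spec (2 * n) (tail_eval n (\<lambda>s. coeff f (2 * s + 1))) = 0"
    unfolding spec_tail_eval_eq_0_iff[OF n] S0_def S1_def by blast
  finally show ?thesis .
qed

text \<open>Vanishing for all values of X1 means that every coefficient in X1 vanishes, so the
  conditions can be imposed row by row.\<close>

lemma U2_iff:
  assumes n: "n \<ge> 1"
  shows "P \<in> U2 n \<longleftrightarrow> P \<in> wedge2_H (2 * n) \<and>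
    (\<forall>i. in_V n (\<lambda>s. co P i (2 * s)) \<and> in_V n (\<lambda>s. co P i (2 * s + 1)))"
proof (cases "P \<in> wedge2_H (2 * n)")
  case True
  have sym: "co P i j \<in> sym_ring (2 * n)" for i j
    using True unfolding wedge2_H_def by blast
  have deg: "coeff (coeff P i) k = 0" if "k \<ge> 2 * n" for i k
    using True that unfolding wedge2_H_def by (metis (mono_tags, lifting) mem_Collect_eq not_le)
  have eval: "(\<forall>z. eval_P P z t a = 0) \<longleftrightarrow> (\<forall>i. poly (map_poly (ev a) (coeff P i)) t = 0)" for t a
  proof -
    have "(\<forall>z. eval_P P z t a = 0) \<longleftrightarrow> map_poly (\<lambda>q. poly (map_poly (ev a) q) t) P = 0"
      unfolding eval_P_def by (rule poly_all_0_iff_0)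
    also have "\<dots> \<longleftrightarrow> (\<forall>i. poly (map_poly (ev a) (coeff P i)) t = 0)"
      by (simp add: poly_eq_iff coeff_map_poly)
    finally show ?thesis .
  qed
  have "P \<in> U2 n \<longleftrightarrow> (\<forall>a x. x \<noteq> 0 \<longrightarrow>
      (\<forall>z. eval_P P z (inverse x) (a(2 * n - 1 := x, 2 * n := - x)) = 0) \<and>
      (\<forall>z. eval_P P z (- inverse x) (a(2 * n - 1 := x, 2 * n := - x)) = 0))"
    using True unfolding U2_def by blast
  also have "\<dots> \<longleftrightarrow> (\<forall>i a x. x \<noteq> 0 \<longrightarrow>
      poly (map_poly (ev (a(2 * n - 1 := x, 2 * n := - x))) (coeff P i)) (inverse x) = 0 \<and>
      poly (map_poly (ev (a(2 * n - 1 := x, 2 * n := - x))) (coeff P i)) (- inverse x) = 0)"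
    unfolding eval by blast
  also have "\<dots> \<longleftrightarrow> (\<forall>i. in_V n (\<lambda>s. co P i (2 * s)) \<and> in_V n (\<lambda>s. co P i (2 * s + 1)))"
    using row_vanishing_iff[OF n, of "coeff P _"] deg sym by (simp add: in_V_def)
  finally show ?thesis using True by blast
qed (simp add: U2_def)


subsection \<open>The basis\<close>

lemma in_V_0: "in_V n (\<lambda>s. 0)"
  by (simp add: in_V_def tail_eval_def)

lemma wedge2_H_D:
  assumes "P \<in> wedge2_H N"
  shows "co P i j \<in> sym_ring N" "\<not> (i < N \<and> j < N) \<Longrightarrow> co P i j = 0" "co P i j = - co P j i"
proof -
  note P = assms[unfolded wedge2_H_def mem_Collect_eq]
  show "co P i j \<in> sym_ring N" by (rule P[THEN conjunct1, rule_format])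
  show "\<not> (i < N \<and> j < N) \<Longrightarrow> co P i j = 0"
    using P[THEN conjunct2, THEN conjunct1, rule_format, of i j] by blast
  show "co P i j = - co P j i" by (rule P[THEN conjunct2, THEN conjunct2, rule_format])
qed

lemma wedge2_H_I:
  assumes "\<And>i j. co P i j \<in> sym_ring N" "\<And>i j. \<not> (i < N \<and> j < N) \<Longrightarrow> co P i j = 0"
    "\<And>i j. co P i j = - co P j i"
  shows "P \<in> wedge2_H N"
  unfolding wedge2_H_def mem_Collect_eq
  by (intro conjI allI impI assms(1,3)) (metis assms(2))+

lemma U2_submodule:
  assumes n: "n \<ge> 1"
  shows "is_submodule (sym_ring (2 * n)) (U2 n)"
  unfolding is_submodule_def
proof (intro conjI ballI)
  show "0 \<in> U2 n" unfolding U2_iff[OF n] by (simp add: wedge2_H_def in_V_0)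
next
  fix P Q assume "P \<in> U2 n" "Q \<in> U2 n"
  then have P: "P \<in> wedge2_H (2 * n)"
      "\<And>i. in_V n (\<lambda>s. co P i (2 * s))" "\<And>i. in_V n (\<lambda>s. co P i (2 * s + 1))"
    and Q: "Q \<in> wedge2_H (2 * n)"
      "\<And>i. in_V n (\<lambda>s. co Q i (2 * s))" "\<And>i. in_V n (\<lambda>s. co Q i (2 * s + 1))"
    unfolding U2_iff[OF n] by blast+
  have "P + Q \<in> wedge2_H (2 * n)"
  proof (rule wedge2_H_I)
    fix i j
    show "co (P + Q) i j \<in> sym_ring (2 * n)"
      using wedge2_H_D(1)[OF P(1)] wedge2_H_D(1)[OF Q(1)] by (simp add: sym_ring_add)
    show "co (P + Q) i j = 0" if "\<not> (i < 2 * n \<and> j < 2 * n)"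
      using wedge2_H_D(2)[OF P(1) that] wedge2_H_D(2)[OF Q(1) that] by simp
    show "co (P + Q) i j = - co (P + Q) j i"
      using wedge2_H_D(3)[OF P(1), of i j] wedge2_H_D(3)[OF Q(1), of i j] by simp
  qed
  then show "P + Q \<in> U2 n"
    unfolding U2_iff[OF n] using in_V_add[OF P(2) Q(2)] in_V_add[OF P(3) Q(3)] by simp
next
  fix c P assume c: "c \<in> sym_ring (2 * n)" and "P \<in> U2 n"
  then have P: "P \<in> wedge2_H (2 * n)"
      "\<And>i. in_V n (\<lambda>s. co P i (2 * s))" "\<And>i. in_V n (\<lambda>s. co P i (2 * s + 1))"
    unfolding U2_iff[OF n] by blast+
  have "scale c P \<in> wedge2_H (2 * n)"
  proof (rule wedge2_H_I)
    fix i j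
    show "co (scale c P) i j \<in> sym_ring (2 * n)"
      using wedge2_H_D(1)[OF P(1)] c by (simp add: co_scale sym_ring_mult)
    show "co (scale c P) i j = 0" if "\<not> (i < 2 * n \<and> j < 2 * n)"
      using wedge2_H_D(2)[OF P(1) that] by (simp add: co_scale)
    show "co (scale c P) i j = - co (scale c P) j i"
      using wedge2_H_D(3)[OF P(1), of i j] by (simp add: co_scale)
  qed
  then show "scale c P \<in> U2 n"
    unfolding U2_iff[OF n] co_scale using in_V_mult[OF P(2) c] in_V_mult[OF P(3) c] by simp
qed

lemma U2_sum:
  assumes "n \<ge> 1" "\<And>x. x \<in> I \<Longrightarrow> f x \<in> U2 n"
  shows "sum f I \<in> U2 n"
  using assms(2)
  by (induction I rule: infinite_finite_induct)
     (use U2_submodule[OF assms(1)] in \<open>auto simp: is_submodule_def\<close>)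

text \<open>The fourth block, with odd first and even second exponent, follows by
  antisymmetry.\<close>

lemma wedge2_H_eqI:
  assumes P: "P \<in> wedge2_H (2 * n)" and Q: "Q \<in> wedge2_H (2 * n)"
    and ee: "\<And>p q. p < n \<Longrightarrow> q < n \<Longrightarrow> co P (2 * p) (2 * q) = co Q (2 * p) (2 * q)"
    and eo: "\<And>p q. p < n \<Longrightarrow> q < n \<Longrightarrow> co P (2 * p) (Suc (2 * q)) = co Q (2 * p) (Suc (2 * q))"
    and oo: "\<And>p q. p < n \<Longrightarrow> q < n \<Longrightarrow>
      co P (Suc (2 * p)) (Suc (2 * q)) = co Q (Suc (2 * p)) (Suc (2 * q))"
  shows "P = Q"
proof (rule co_eqI)
  fix i j
  show "co P i j = co Q i j"
  proof (cases "i < 2 * n \<and> j < 2 * n")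
    case False
    from wedge2_H_D(2)[OF P this] wedge2_H_D(2)[OF Q this] show ?thesis by simp
  next
    case True
    show ?thesis
    proof (cases i rule: nat_parity_cases; cases j rule: nat_parity_cases)
      fix p q assume "i = Suc (2 * p)" "j = 2 * q"
      with True eo[of q p] wedge2_H_D(3)[OF P, of i j] wedge2_H_D(3)[OF Q, of i j]
      show ?thesis by simp
    qed (use True ee eo oo in auto)
  qed
qed

text \<open>What a polynomial in one variable has to satisfy so that wedges of two such polynomials
  lie in \<open>U2 n\<close>.\<close>

definition row_poly :: "nat \<Rightarrow> mpol poly \<Rightarrow> bool" where
  "row_poly n f \<longleftrightarrow> (\<forall>k. coeff f k \<in> sym_ring (2 * n)) \<and> (\<forall>k\<ge>2 * n. coeff f k = 0) \<and>
     in_V n (\<lambda>s. coeff f (2 * s)) \<and> in_V n (\<lambda>s. coeff f (2 * s + 1))"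

lemma row_poly_v: "n \<ge> 1 \<Longrightarrow> row_poly n (v n (Suc r))"
  by (auto simp: row_poly_def coeff_v Pvec_in_V in_V_0)

lemma row_poly_w: "n \<ge> 1 \<Longrightarrow> row_poly n (w n (Suc r))"
  by (auto simp: row_poly_def coeff_w Pvec_in_V in_V_0)

lemma wedge_in_U2:
  assumes n: "n \<ge> 1" and f: "row_poly n f" and g: "row_poly n g"
  shows "wedge f g \<in> U2 n"
proof -
  have sym: "coeff f k \<in> sym_ring (2 * n)" "coeff g k \<in> sym_ring (2 * n)" for k
    using f g by (auto simp: row_poly_def)
  have deg: "coeff f k = 0" "coeff g k = 0" if "\<not> k < 2 * n" for k
    using f g that by (auto simp: row_poly_def)
  have "in_V n (\<lambda>s. coeff f i * coeff g (h s) - coeff f (h s) * coeff g i)"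
    if "in_V n (\<lambda>s. coeff f (h s))" "in_V n (\<lambda>s. coeff g (h s))" for h i
  proof -
    have "in_V n (\<lambda>s. coeff f i * coeff g (h s) + - coeff g i * coeff f (h s))"
      by (intro in_V_add in_V_mult that sym sym_ring_minus)
    then show ?thesis by (simp add: mult.commute)
  qed
  moreover have "wedge f g \<in> wedge2_H (2 * n)"
  proof (rule wedge2_H_I)
    show "co (wedge f g) i j = 0" if "\<not> (i < 2 * n \<and> j < 2 * n)" for i j
      using that deg by (auto simp: co_wedge)
  qed (auto simp: co_wedge intro!: sym_ring_diff sym_ring_mult sym)
  ultimately show ?thesis
    using f g by (simp add: U2_iff[OF n] co_wedge row_poly_def)
qed

lemma xi_in_U2:
  assumes n: "n \<ge> 1"
  shows "xi n (Suc k) \<in> U2 n"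
proof -
  have "xi n (Suc k) \<in> wedge2_H (2 * n)"
  proof (rule wedge2_H_I)
    fix i j
    show "co (xi n (Suc k)) i j \<in> sym_ring (2 * n)" by (auto simp: co_xi intro: sym_ring_minus)
    show "co (xi n (Suc k)) i j = 0" if "\<not> (i < 2 * n \<and> j < 2 * n)"
    proof -
      from that have "n \<le> i div 2 \<or> n \<le> j div 2" by linarith
      then show ?thesis by (auto simp: co_xi)
    qed
    show "co (xi n (Suc k)) i j = - co (xi n (Suc k)) j i"
      by (simp add: co_xi xi_mat_commute[of n k "j div 2"])
  qed
  moreover have "in_V n (\<lambda>s. - xi_mat n k p s)" for p
    using in_V_mult[OF xi_mat_in_V[OF n, of k p], of "- 1"] by (simp add: sym_ring_minus)
  then have "in_V n (\<lambda>s. co (xi n (Suc k)) i (2 * s))"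
      "in_V n (\<lambda>s. co (xi n (Suc k)) i (2 * s + 1))" for i
    by (cases "even i"; simp add: co_xi in_V_0 xi_mat_in_V[OF n])+
  ultimately show ?thesis by (simp only: U2_iff[OF n] simp_thms)
qed

section \<open>Enumeration of the basis and its coefficients\<close>

text \<open>The larger index comes first, so that summation over the pairs is a double sum over
  \<open>j\<close> and \<open>i < j\<close>.\<close>

definition index_pairs :: "nat \<Rightarrow> (nat \<times> nat) set" where
  "index_pairs n = Sigma {..<2 * n} (\<lambda>j. {..<j})"

text \<open>The basis is indexed by the pairs \<open>i < j < 2 n\<close>, with \<open>i < n\<close> standing for
  \<open>v\<^sub>i\<^sub>+\<^sub>1\<close>, \<open>n + i\<close> for \<open>w\<^sub>i\<^sub>+\<^sub>1\<close>, and \<open>\<xi>\<^sub>i\<^sub>+\<^sub>1\<close> in the place of \<open>v\<^sub>i\<^sub>+\<^sub>1 \<and> w\<^sub>n\<close>.\<close>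

fun basis_elem :: "nat \<Rightarrow> nat \<times> nat \<Rightarrow> mpol poly poly" where
  "basis_elem n (j, i) =
    (if j < n then wedge (v n (Suc i)) (v n (Suc j))
     else if n \<le> i then wedge (w n (Suc (i - n))) (w n (Suc (j - n)))
     else if j = 2 * n - 1 then xi n (Suc i)
     else wedge (v n (Suc i)) (w n (Suc (j - n))))"

declare basis_elem.simps [simp del]

lemma card_index_pairs: "card (index_pairs n) = (2 * n) choose 2"
proof -
  have "(\<Sum>j<m. j) = m choose 2" for m
    by (induction m) (simp_all add: numeral_2_eq_2)
  then show ?thesis by (simp add: index_pairs_def card_SigmaI)
qed

lemma sum_lessThan_add:
  fixes f :: "nat \<Rightarrow> 'a::comm_monoid_add"
  shows "(\<Sum>i<n + m. f i) = (\<Sum>i<n. f i) + (\<Sum>i<m. f (n + i))"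
  by (induction m) (simp_all add: add.assoc)

text \<open>The triangle below 2 n splits into a triangle for the v, a square for v against w, and a
  triangle for the w.\<close>

lemma sum_index_pairs:
  fixes f :: "nat \<times> nat \<Rightarrow> 'a::comm_monoid_add"
  shows "(\<Sum>x\<in>index_pairs n. f x) = (\<Sum>j<n. \<Sum>i<j. f (j, i)) +
    ((\<Sum>r<n. \<Sum>i<n. f (n + r, i)) + (\<Sum>j<n. \<Sum>i<j. f (n + j, n + i)))"
proof -
  have "(\<Sum>x\<in>index_pairs n. f x) = (\<Sum>j<n + n. \<Sum>i<j. f (j, i))"
    by (simp add: index_pairs_def sum.Sigma mult_2)
  then show ?thesis by (simp add: sum_lessThan_add sum.distrib)
qed

lemma basis_elem_in_U2:
  assumes "n \<ge> 1"
  shows "basis_elem n x \<in> U2 n"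
  by (cases x) (auto simp: basis_elem.simps
    intro!: assms wedge_in_U2[OF assms] xi_in_U2[OF assms] row_poly_v row_poly_w)

lemma co_basis_elem_vv:
  assumes "j < n"
  shows "co (basis_elem n (j, i)) (2 * p) (2 * q) = Pvec n i p * Pvec n j q - Pvec n j p * Pvec n i q"
    "co (basis_elem n (j, i)) (2 * p) (Suc (2 * q)) = 0"
    "co (basis_elem n (j, i)) (Suc (2 * p)) (Suc (2 * q)) = 0"
  using assms by (simp_all add: basis_elem.simps co_wedge coeff_v mult.commute)

lemma co_basis_elem_ww:
  "co (basis_elem n (n + j, n + i)) (2 * p) (2 * q) = 0"
  "co (basis_elem n (n + j, n + i)) (2 * p) (Suc (2 * q)) = 0"
  "co (basis_elem n (n + j, n + i)) (Suc (2 * p)) (Suc (2 * q)) =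
    Pvec n i p * Pvec n j q - Pvec n j p * Pvec n i q"
  by (simp_all add: basis_elem.simps co_wedge coeff_w mult.commute)

lemma co_basis_elem_vw:
  assumes "i < n"
  shows "co (basis_elem n (n + r, i)) (2 * p) (2 * q) = 0"
    "co (basis_elem n (n + r, i)) (2 * p) (Suc (2 * q)) =
      (if r = n - 1 then xi_mat n i p q else Pvec n i p * Pvec n r q)"
    "co (basis_elem n (n + r, i)) (Suc (2 * p)) (Suc (2 * q)) = 0"
proof -
  have "n + r = 2 * n - 1 \<longleftrightarrow> r = n - 1" using assms by linarith
  then show "co (basis_elem n (n + r, i)) (2 * p) (2 * q) = 0"
    "co (basis_elem n (n + r, i)) (2 * p) (Suc (2 * q)) =
      (if r = n - 1 then xi_mat n i p q else Pvec n i p * Pvec n r q)"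
    "co (basis_elem n (n + r, i)) (Suc (2 * p)) (Suc (2 * q)) = 0"
    using assms by (simp_all add: basis_elem.simps co_wedge co_xi coeff_v coeff_w)
qed

text \<open>Each of these three blocks sees only one part of the index set, so spanning and
  independence can be treated block by block.\<close>

lemma co_combination:
  assumes n: "n \<ge> 1"
  defines "S \<equiv> \<lambda>c. \<Sum>x\<in>index_pairs n. scale (c x) (basis_elem n x)"
  shows "co (S c) (2 * p) (2 * q) =
      (\<Sum>j<n. \<Sum>i<j. c (j, i) * (Pvec n i p * Pvec n j q - Pvec n j p * Pvec n i q))"
    and "co (S c) (Suc (2 * p)) (Suc (2 * q)) =
      (\<Sum>j<n. \<Sum>i<j. c (n + j, n + i) * (Pvec n i p * Pvec n j q - Pvec n j p * Pvec n i q))"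
    and "co (S c) (2 * p) (Suc (2 * q)) =
      (\<Sum>k<n. c (2 * n - 1, k) * xi_mat n k p q) +
      (\<Sum>r<n - 1. \<Sum>i<n. c (n + r, i) * (Pvec n i p * Pvec n r q))"
proof -
  show "co (S c) (2 * p) (2 * q) =
      (\<Sum>j<n. \<Sum>i<j. c (j, i) * (Pvec n i p * Pvec n j q - Pvec n j p * Pvec n i q))"
    "co (S c) (Suc (2 * p)) (Suc (2 * q)) =
      (\<Sum>j<n. \<Sum>i<j. c (n + j, n + i) * (Pvec n i p * Pvec n j q - Pvec n j p * Pvec n i q))"
    unfolding S_def co_sum unfolding co_scale sum_index_pairs
    by (simp_all add: co_basis_elem_vv co_basis_elem_ww co_basis_elem_vw)
  have "co (S c) (2 * p) (Suc (2 * q)) =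
      (\<Sum>r<n. \<Sum>i<n. c (n + r, i) * (if r = n - 1 then xi_mat n i p q else Pvec n i p * Pvec n r q))"
    unfolding S_def co_sum unfolding co_scale sum_index_pairs
    by (simp add: co_basis_elem_vv co_basis_elem_ww co_basis_elem_vw)
  also have "\<dots> = (\<Sum>r<n - 1. \<Sum>i<n. c (n + r, i) * (Pvec n i p * Pvec n r q)) +
      (\<Sum>k<n. c (n + (n - 1), k) * xi_mat n k p q)"
    unfolding sum_lessThan_pred[OF n] by simp
  also have "n + (n - 1) = 2 * n - 1" using n by simp
  finally show "co (S c) (2 * p) (Suc (2 * q)) =
      (\<Sum>k<n. c (2 * n - 1, k) * xi_mat n k p q) +
      (\<Sum>r<n - 1. \<Sum>i<n. c (n + r, i) * (Pvec n i p * Pvec n r q))"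
    by (simp only: add.commute)
qed

lemma basis_elem_spans:
  assumes n: "n \<ge> 1" and P: "P \<in> U2 n"
  obtains c where "\<And>x. x \<in> index_pairs n \<Longrightarrow> c x \<in> sym_ring (2 * n)"
    "P = (\<Sum>x\<in>index_pairs n. scale (c x) (basis_elem n x))"
proof -
  have wedge: "P \<in> wedge2_H (2 * n)"
    and rows: "in_V n (\<lambda>s. co P i (2 * s))" "in_V n (\<lambda>s. co P i (Suc (2 * s)))" for i
    using P unfolding U2_iff[OF n] by simp_all
  note anti = wedge2_H_D(3)[OF wedge]
  obtain \<alpha> where \<alpha>: "\<And>i j. i < n \<Longrightarrow> j < n \<Longrightarrow> \<alpha> i j \<in> sym_ring (2 * n)"
    "\<And>i j. \<alpha> i j = - \<alpha> j i" "\<And>i. \<alpha> i i = 0"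
    "\<And>p q. p < n \<Longrightarrow> q < n \<Longrightarrow> co P (2 * p) (2 * q) =
      (\<Sum>j<n. \<Sum>i<n. \<alpha> i j * (Pvec n i p * Pvec n j q))"
    by (rule antisymmetric_block_span[OF n, of "\<lambda>p q. co P (2 * p) (2 * q)"])
       (rule rows, rule anti, rule that, assumption+)
  obtain \<gamma> where \<gamma>: "\<And>i j. i < n \<Longrightarrow> j < n \<Longrightarrow> \<gamma> i j \<in> sym_ring (2 * n)"
    "\<And>i j. \<gamma> i j = - \<gamma> j i" "\<And>i. \<gamma> i i = 0"
    "\<And>p q. p < n \<Longrightarrow> q < n \<Longrightarrow> co P (Suc (2 * p)) (Suc (2 * q)) =
      (\<Sum>j<n. \<Sum>i<n. \<gamma> i j * (Pvec n i p * Pvec n j q))"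
    by (rule antisymmetric_block_span[OF n, of "\<lambda>p q. co P (Suc (2 * p)) (Suc (2 * q))"])
       (rule rows, rule anti, rule that, assumption+)
  have cols: "in_V n (\<lambda>p. co P (2 * p) (Suc (2 * q)))" for q
  proof -
    have "in_V n (\<lambda>p. - 1 * co P (Suc (2 * q)) (2 * p))"
      by (intro in_V_mult rows sym_ring_minus) simp
    moreover have "(\<lambda>p. - 1 * co P (Suc (2 * q)) (2 * p)) = (\<lambda>p. co P (2 * p) (Suc (2 * q)))"
      using anti[of _ "Suc (2 * q)"] by (simp add: fun_eq_iff)
    ultimately show ?thesis by simp
  qed
  obtain \<beta> d where d: "\<And>k. k < n \<Longrightarrow> \<beta> k \<in> sym_ring (2 * n)"
    "\<And>j r. j < n \<Longrightarrow> r < n - 1 \<Longrightarrow> d j r \<in> sym_ring (2 * n)"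
    "\<And>p q. p < n \<Longrightarrow> q < n \<Longrightarrow> co P (2 * p) (Suc (2 * q)) =
      (\<Sum>k<n. \<beta> k * xi_mat n k p q) + (\<Sum>r<n - 1. \<Sum>j<n. d j r * (Pvec n j p * Pvec n r q))"
    by (rule block_span[OF n, of "\<lambda>p q. co P (2 * p) (Suc (2 * q))"])
       (rule rows, rule cols, rule that, assumption+)
  define c where "c = (\<lambda>(j, i). if j < n then \<alpha> i j else if n \<le> i then \<gamma> (i - n) (j - n)
     else if j = 2 * n - 1 then \<beta> i else d i (j - n))"
  have c: "c x \<in> sym_ring (2 * n)" if "x \<in> index_pairs n" for x
    using that \<alpha>(1) \<gamma>(1) d(1,2) by (auto simp: c_def index_pairs_def)
  have "P = (\<Sum>x\<in>index_pairs n. scale (c x) (basis_elem n x))" (is "P = ?S")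
  proof (rule wedge2_H_eqI[OF wedge])
    have "scale (c x) (basis_elem n x) \<in> U2 n" if "x \<in> index_pairs n" for x
      using c[OF that] basis_elem_in_U2[OF n] U2_submodule[OF n] unfolding is_submodule_def by blast
    then have "?S \<in> U2 n" by (rule U2_sum[OF n])
    then show "?S \<in> wedge2_H (2 * n)" by (simp add: U2_def)
    fix p q assume pq: "p < n" "q < n"
    have "co P (2 * p) (2 * q) = (\<Sum>j<n. \<Sum>i<j. \<alpha> i j * (Pvec n i p * Pvec n j q - Pvec n j p * Pvec n i q))"
      unfolding \<alpha>(4)[OF pq] using \<alpha>(2,3) by (rule sum_antisymmetric)
    also have "\<dots> = co ?S (2 * p) (2 * q)"
      unfolding co_combination[OF n] by (simp add: c_def)
    finally show "co P (2 * p) (2 * q) = co ?S (2 * p) (2 * q)" .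
    have "co P (Suc (2 * p)) (Suc (2 * q)) =
        (\<Sum>j<n. \<Sum>i<j. \<gamma> i j * (Pvec n i p * Pvec n j q - Pvec n j p * Pvec n i q))"
      unfolding \<gamma>(4)[OF pq] using \<gamma>(2,3) by (rule sum_antisymmetric)
    also have "\<dots> = co ?S (Suc (2 * p)) (Suc (2 * q))"
      unfolding co_combination[OF n] by (simp add: c_def)
    finally show "co P (Suc (2 * p)) (Suc (2 * q)) = co ?S (Suc (2 * p)) (Suc (2 * q))" .
    show "co P (2 * p) (Suc (2 * q)) = co ?S (2 * p) (Suc (2 * q))"
      unfolding co_combination[OF n] d(3)[OF pq]
      by (intro arg_cong2[of _ _ _ _ "(+)"] sum.cong refl) (auto simp: c_def)
  qed
  with c that show ?thesis by blast
qed

lemma basis_elem_independent: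
  assumes n: "n \<ge> 1" and 0: "(\<Sum>x\<in>index_pairs n. scale (c x) (basis_elem n x)) = 0"
    and x: "x \<in> index_pairs n"
  shows "c x = 0"
proof -
  obtain j i where ji: "x = (j, i)" "i < j" "j < 2 * n"
    using x by (auto simp: index_pairs_def)
  have zero: "co (\<Sum>x\<in>index_pairs n. scale (c x) (basis_elem n x)) a b = 0" for a b
    unfolding 0 by simp
  note co = zero[of "2 * _" "2 * _", unfolded co_combination(1)[OF n]]
    zero[of "Suc (2 * _)" "Suc (2 * _)", unfolded co_combination(2)[OF n]]
    zero[of "2 * _" "Suc (2 * _)", unfolded co_combination(3)[OF n]]
  consider "j < n" | "n \<le> i" | "i < n" "n \<le> j" "j = 2 * n - 1" | "i < n" "n \<le> j" "j < 2 * n - 1"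
    using ji by linarith
  then show ?thesis
  proof cases
    case 1
    have "(\<lambda>i j. c (j, i)) i j = 0"
      by (rule antisymmetric_independent[OF n _ ji(2) 1]) (rule co(1))
    then show ?thesis by (simp add: ji)
  next
    case 2
    have "(\<lambda>i j. c (n + j, n + i)) (i - n) (j - n) = 0"
      by (rule antisymmetric_independent[OF n]) (rule co(2), use 2 ji in auto)
    with 2 ji show ?thesis by simp
  next
    case 3
    have "(\<lambda>k. c (2 * n - 1, k)) i = 0"
      by (rule mixed_independent(1)[OF n _ 3(1), of _ "\<lambda>i r. c (n + r, i)"]) (rule co(3))
    with 3 ji show ?thesis by simp
  next
    case 4
    then have r: "j - n < n - 1" by simp
    have "(\<lambda>i r. c (n + r, i)) i (j - n) = 0"
      by (rule mixed_independent(2)[OF n _ 4(1) r, of "\<lambda>k. c (2 * n - 1, k)"]) (rule co(3))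
    with 4 ji show ?thesis by simp
  qed
qed

section \<open>From an indexed family to a basis as a set\<close>

text \<open>Equal members at different indices would satisfy the relation with coefficients 1 and
  -1, so independence makes the family injective. This also gives the rank.\<close>

lemma finite_basis_of_family:
  fixes b :: "'i \<Rightarrow> 'a::comm_ring_1 poly poly"
  assumes fin: "finite I" and in_U: "\<And>x. x \<in> I \<Longrightarrow> b x \<in> U"
    and R: "0 \<in> R" "1 \<in> R" "- 1 \<in> R"
    and span: "\<And>P. P \<in> U \<Longrightarrow> \<exists>c. (\<forall>x\<in>I. c x \<in> R) \<and> P = (\<Sum>x\<in>I. scale (c x) (b x))"
    and indep: "\<And>c x. (\<forall>x\<in>I. c x \<in> R) \<Longrightarrow> (\<Sum>x\<in>I. scale (c x) (b x)) = 0 \<Longrightarrow> x \<in> I \<Longrightarrow> c x = 0"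
  shows "is_finite_basis R U (b ` I)" "card (b ` I) = card I"
proof -
  have inj: "inj_on b I"
  proof (rule inj_onI, rule ccontr)
    fix x y assume xy: "x \<in> I" "y \<in> I" "b x = b y" "x \<noteq> y"
    define c :: "'i \<Rightarrow> 'a" where "c z = (if z = x then 1 else if z = y then - 1 else 0)" for z
    have "(\<Sum>z\<in>I. scale (c z) (b z)) = (\<Sum>z\<in>{x, y}. scale (c z) (b z))"
      using xy fin by (intro sum.mono_neutral_right) (auto simp: c_def scale_def)
    also have "\<dots> = 0" using xy by (simp add: c_def scale_def flip: smult_add_left)
    finally have "(\<Sum>z\<in>I. scale (c z) (b z)) = 0" .
    moreover have "\<forall>z\<in>I. c z \<in> R" using R by (auto simp: c_def)
    ultimately have "c x = 0" using indep[of c x] xy(1) by blast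
    then show False by (simp add: c_def)
  qed
  then show "card (b ` I) = card I" by (rule card_image)
  show "is_finite_basis R U (b ` I)"
    unfolding is_finite_basis_def
  proof (intro conjI ballI allI impI)
    show "finite (b ` I)" "b ` I \<subseteq> U" using fin in_U by auto
  next
    fix P assume "P \<in> U"
    then obtain c where c: "\<forall>x\<in>I. c x \<in> R" "P = (\<Sum>x\<in>I. scale (c x) (b x))"
      using span by blast
    show "\<exists>c. (\<forall>y\<in>b ` I. c y \<in> R) \<and> P = (\<Sum>y\<in>b ` I. scale (c y) y)"
      using c inj
      by (intro exI[of _ "\<lambda>y. c (the_inv_into I b y)"]) (simp add: sum.reindex the_inv_into_f_f)
  next
    fix c y assume c: "\<forall>y\<in>b ` I. c y \<in> R" "(\<Sum>y\<in>b ` I. scale (c y) y) = 0" and "y \<in> b ` I"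
    then obtain x where x: "y = b x" "x \<in> I" by blast
    from c(2) have "(\<Sum>x\<in>I. scale (c (b x)) (b x)) = 0" by (simp add: sum.reindex[OF inj])
    from indep[of "\<lambda>x. c (b x)", OF _ this x(2)] c(1) x(1) show "c y = 0" by simp
  qed
qed

lemma U2_basis_eq:
  assumes n: "n \<ge> 1"
  shows "U2_basis n = basis_elem n ` index_pairs n"
proof
  show "U2_basis n \<subseteq> basis_elem n ` index_pairs n"
  proof
    fix x assume "x \<in> U2_basis n"
    then consider
        i1 i2 where "x = wedge (v n i1) (v n i2)" "1 \<le> i1" "i1 < i2" "i2 \<le> n"
      | j1 j2 where "x = wedge (w n j1) (w n j2)" "1 \<le> j1" "j1 < j2" "j2 \<le> n"
      | i j where "x = wedge (v n i) (w n j)" "1 \<le> i" "i \<le> n" "1 \<le> j" "j \<le> n - 1"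
      | k where "x = xi n k" "1 \<le> k" "k \<le> n"
      unfolding U2_basis_def by blast
    then show "x \<in> basis_elem n ` index_pairs n"
    proof cases
      case 1
      then show ?thesis
        by (intro image_eqI[of _ _ "(i2 - 1, i1 - 1)"]) (auto simp: basis_elem.simps index_pairs_def)
    next
      case 2
      then show ?thesis
        by (intro image_eqI[of _ _ "(n + (j2 - 1), n + (j1 - 1))"])
          (auto simp: basis_elem.simps index_pairs_def)
    next
      case 3
      then show ?thesis
        by (intro image_eqI[of _ _ "(n + (j - 1), i - 1)"])
          (auto simp: basis_elem.simps index_pairs_def)
    next
      case 4
      then show ?thesis using n
        by (intro image_eqI[of _ _ "(2 * n - 1, k - 1)"])
          (auto simp: basis_elem.simps index_pairs_def)
    qed
  qed
  show "basis_elem n ` index_pairs n \<subseteq> U2_basis n"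
  proof
    fix x assume "x \<in> basis_elem n ` index_pairs n"
    then obtain j i where x: "x = basis_elem n (j, i)" and ij: "i < j" "j < 2 * n"
      by (auto simp: index_pairs_def)
    consider "j < n" | "n \<le> i" | "i < n" "n \<le> j" "j = 2 * n - 1" | "i < n" "n \<le> j" "j < 2 * n - 1"
      using ij by linarith
    then show "x \<in> U2_basis n"
    proof cases
      case 1
      then have "x = wedge (v n (Suc i)) (v n (Suc j))" "1 \<le> Suc i" "Suc i < Suc j" "Suc j \<le> n"
        using ij by (auto simp: x basis_elem.simps)
      then show ?thesis unfolding U2_basis_def by blast
    next
      case 2
      then have "x = wedge (w n (Suc (i - n))) (w n (Suc (j - n)))"
          "1 \<le> Suc (i - n)" "Suc (i - n) < Suc (j - n)" "Suc (j - n) \<le> n"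
        using ij by (auto simp: x basis_elem.simps)
      then show ?thesis unfolding U2_basis_def by blast
    next
      case 3
      then have "x = xi n (Suc i)" "1 \<le> Suc i" "Suc i \<le> n"
        by (auto simp: x basis_elem.simps)
      then show ?thesis unfolding U2_basis_def by blast
    next
      case 4
      then have "x = wedge (v n (Suc i)) (w n (Suc (j - n)))"
          "1 \<le> Suc i" "Suc i \<le> n" "1 \<le> Suc (j - n)" "Suc (j - n) \<le> n - 1"
        by (auto simp: x basis_elem.simps)
      then show ?thesis unfolding U2_basis_def by blast
    qed
  qed
qed

theorem theorem4:
  fixes n :: nat
  assumes "n \<ge> 1"
  shows "is_submodule (sym_ring (2 * n)) (U2 n) \<and>
    is_finite_basis (sym_ring (2 * n)) (U2 n) (U2_basis n) \<and>
    card (U2_basis n) = (2 * n) choose 2"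
proof -
  have "finite (index_pairs n)" by (simp add: index_pairs_def)
  moreover have "\<exists>c. (\<forall>x\<in>index_pairs n. c x \<in> sym_ring (2 * n)) \<and>
      P = (\<Sum>x\<in>index_pairs n. scale (c x) (basis_elem n x))" if "P \<in> U2 n" for P
    using basis_elem_spans[OF assms that] by metis
  ultimately have "is_finite_basis (sym_ring (2 * n)) (U2 n) (basis_elem n ` index_pairs n)"
    "card (basis_elem n ` index_pairs n) = card (index_pairs n)"
    using finite_basis_of_family[of "index_pairs n" "basis_elem n" "U2 n" "sym_ring (2 * n)"]
      basis_elem_in_U2[OF assms] basis_elem_independent[OF assms] sym_ring_minus
    by auto
  then show ?thesis
    using U2_submodule[OF assms] by (simp add: U2_basis_eq[OF assms] card_index_pairs)
qed



end
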